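(* Suppose we have MONI (the index described in the context) for a text $T[0..n-1]$ whose Burrows--Wheeler Transform consists of $r$ runs. Then we can add to MONI a data structure of $O(r \log n)$ bits such that, given at query time any integer $k \geq 1$ and any pattern $P[0..m-1]$, we can find the $k$-MEMs of $P$ with respect to $T$ online in $O(k \log n)$ time per character of $P$ (and hence in $O(k m \log n)$ total time).
   Context: Strings are indexed from $0$. The text $T[0..n-1]$ is a string over an ordered alphabet, terminated by a unique end-of-string symbol $\$$ smaller than all other symbols. Bounds are in the word RAM model with words of $\Theta(\log n)$ bits. $k$-MEMs: for an integer $k \geq 1$, a $k$-MEM of $P[0..m-1]$ with respect to $T$ is a non-empty substring $P[i..j]$ (identified by the pair $(i,j)$) that occurs at least $k$ times in $T$ and is maximal with this property, that is, ($i = 0$ or $P[i-1..j]$ occurs fewer than $k$ times in $T$) and ($j = m-1$ or $P[i..j+1]$ occurs fewer than $k$ times in $T$). Suffix array and BWT: $\mathrm{SA}[0..n-1]$ is the suffix array of $T$; $\mathrm{BWT}[q] = T[(\mathrm{SA}[q]-1) \bmod n]$; $\mathrm{LF}$ is the permutation of $\{0,\dots,n-1\}$ with $\mathrm{SA}[\mathrm{LF}(q)] = (\mathrm{SA}[q]-1) \bmod n$. A run is a maximal interval of positions on which BWT is constant; the runs, from left to right, are numbered $0,\dots,r-1$, and run $j$ occupies positions $\mathrm{head}(j)..\mathrm{tail}(j)$. $\mathrm{LCE}(a,b)$ is the length of the longest common prefix of $T[a..n-1]$ and $T[b..n-1]$. MONI for $T$ consists of: (1) a table with, for each $j \in \{0,\dots,r-1\}$,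 the values $\mathrm{head}(j)$, $\mathrm{SA}[\mathrm{head}(j)]$, $\mathrm{tail}(j)$, $\mathrm{SA}[\mathrm{tail}(j)]$, $\mathrm{BWT}[\mathrm{head}(j)]$, $\mu(j)$ and $\mathrm{finger}(j)$, where $\mu(0) < \dots < \mu(r-1)$ are the values $\mathrm{LF}(\mathrm{head}(0)),\dots,\mathrm{LF}(\mathrm{head}(r-1))$ in sorted order and $\mathrm{finger}(j)$ is the number of the run of the BWT containing position $\mu(j)$; the column $\mathrm{BWT}[\mathrm{head}(j)]$ is kept in a wavelet tree; this part takes $O(r \log n)$ bits; and (2) a data structure answering LCE queries on $T$ in $O(\log n)$ time (e.g., a balanced straight-line program for $T$). "Online" means that the characters of $P$ are processed one at a time from $P[m-1]$ to $P[0]$, with the stated time spent per character, and that whether a $k$-MEM starts at position $i$, and which one, is determined once $P[i-1]$ has been processed (once $P[0]$ has been processed, if $i = 0$). *)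

theory Defs
  imports Main "HOL-Library.List_Lexorder" "HOL-Library.Log_Nat"
begin

section \<open>Strings, texts and k-MEMs\<close>

text \<open>Symbols are machine words, hence natural numbers; the order of the alphabet is the
  order of the numbers.\<close>

type_synonym str = "nat list"

definition is_text :: "str \<Rightarrow> bool" where
  "is_text T \<longleftrightarrow> T \<noteq> [] \<and> (\<forall>x \<in> set (butlast T). last T < x)"

definition substring :: "str \<Rightarrow> nat \<Rightarrow> nat \<Rightarrow> str" where
  "substring P i j = take (j + 1 - i) (drop i P)"

definition occurrences :: "str \<Rightarrow> str \<Rightarrow> nat" where
  "occurrences S T = card {p. p + length S \<le> length T \<and> take (length S) (drop p T) = S}"

definition is_kmem :: "nat \<Rightarrow> str \<Rightarrow> str \<Rightarrow> nat \<Rightarrow> nat \<Rightarrow> bool" where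
  "is_kmem k P T i j \<longleftrightarrow>
     i \<le> j \<and> j < length P \<and>
     k \<le> occurrences (substring P i j) T \<and>
     (i = 0 \<or> occurrences (substring P (i - 1) j) T < k) \<and>
     (j = length P - 1 \<or> occurrences (substring P i (j + 1)) T < k)"


section \<open>Suffix array, BWT, LF and runs\<close>

text \<open>Lists are ordered lexicographically.\<close>

definition SA :: "str \<Rightarrow> nat list" where
  "SA T = sort_key (\<lambda>p. drop p T) [0..<length T]"

definition prev_pos :: "str \<Rightarrow> nat \<Rightarrow> nat" where
  "prev_pos T p = (p + length T - 1) mod length T"

definition BWT :: "str \<Rightarrow> nat \<Rightarrow> nat" where
  "BWT T q = T ! prev_pos T (SA T ! q)"

definition LF :: "str \<Rightarrow> nat \<Rightarrow> nat" where
  "LF T q = (THE q'. q' < length T \<and> SA T ! q' = prev_pos T (SA T ! q))"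

definition is_run :: "str \<Rightarrow> nat \<Rightarrow> nat \<Rightarrow> bool" where
  "is_run T a b \<longleftrightarrow>
     a \<le> b \<and> b < length T \<and>
     (\<forall>q \<in> {a..b}. BWT T q = BWT T a) \<and>
     (a = 0 \<or> BWT T (a - 1) \<noteq> BWT T a) \<and>
     (b = length T - 1 \<or> BWT T (b + 1) \<noteq> BWT T b)"

definition num_runs :: "str \<Rightarrow> nat" where
  "num_runs T = card {(a, b). is_run T a b}"

definition run_head :: "str \<Rightarrow> nat \<Rightarrow> nat" where
  "run_head T j = sorted_list_of_set {a. \<exists>b. is_run T a b} ! j"

definition run_tail :: "str \<Rightarrow> nat \<Rightarrow> nat" where
  "run_tail T j = (THE b. is_run T (run_head T j) b)"

definition mu :: "str \<Rightarrow> nat \<Rightarrow> nat" where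
  "mu T j = sort (map (\<lambda>i. LF T (run_head T i)) [0..<num_runs T]) ! j"

definition finger :: "str \<Rightarrow> nat \<Rightarrow> nat" where
  "finger T j = (THE i. i < num_runs T \<and> run_head T i \<le> mu T j \<and> mu T j \<le> run_tail T i)"

definition LCE :: "str \<Rightarrow> nat \<Rightarrow> nat \<Rightarrow> nat" where
  "LCE T a b = Max {l. l \<le> length T - a \<and> l \<le> length T - b \<and>
                       take l (drop a T) = take l (drop b T)}"

text \<open>The number of bits of \<open>n\<close>, that is \<open>\<lfloor>log\<^sub>2 n\<rfloor> + 1\<close> for \<open>n \<ge> 1\<close>. It stands for
  \<open>log n\<close> in all asymptotic bounds, so that they also make sense for \<open>n = 1\<close>.\<close>

definition lg :: "nat \<Rightarrow> nat" where
  "lg n = floorlog 2 n"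


section \<open>MONI\<close>

datatype column = Head | SA_Head | Tail | SA_Tail | Mu | Finger

fun column_entry :: "str \<Rightarrow> column \<Rightarrow> nat \<Rightarrow> nat" where
  "column_entry T Head j = run_head T j"
| "column_entry T SA_Head j = SA T ! run_head T j"
| "column_entry T Tail j = run_tail T j"
| "column_entry T SA_Tail j = SA T ! run_tail T j"
| "column_entry T Mu j = mu T j"
| "column_entry T Finger j = finger T j"

text \<open>The wavelet tree of the column \<open>BWT[head(j)]\<close> and the LCE structure are black boxes,
  accessible only through their queries. A query returns a pair: the answer and the time spent.\<close>

record moni =
  table :: "column \<Rightarrow> nat list"
  wt_access :: "nat \<Rightarrow> nat \<times> nat"
  wt_rank :: "nat \<Rightarrow> nat \<Rightarrow> nat \<times> nat"
  wt_select :: "nat \<Rightarrow> nat \<Rightarrow> nat \<times> nat"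
  lce_query :: "nat \<Rightarrow> nat \<Rightarrow> nat \<times> nat"

definition run_rank :: "str \<Rightarrow> nat \<Rightarrow> nat \<Rightarrow> nat" where
  "run_rank T x j = card {i. i < j \<and> BWT T (run_head T i) = x}"

text \<open>All queries within their domains take time at most \<open>c * lg n\<close>; nothing is assumed about
  other queries. In \<open>wt_select\<close>, occurrences are counted from 0.\<close>

definition is_moni :: "nat \<Rightarrow> str \<Rightarrow> moni \<Rightarrow> bool" where
  "is_moni c T M \<longleftrightarrow>
     (\<forall>col. table M col = map (column_entry T col) [0..<num_runs T]) \<and>
     (\<forall>j < num_runs T.
        fst (wt_access M j) = BWT T (run_head T j) \<and>
        snd (wt_access M j) \<le> c * lg (length T)) \<and>
     (\<forall>x. \<forall>j \<le> num_runs T.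
        fst (wt_rank M x j) = run_rank T x j \<and>
        snd (wt_rank M x j) \<le> c * lg (length T)) \<and>
     (\<forall>x. \<forall>i < run_rank T x (num_runs T).
        fst (wt_select M x i) < num_runs T \<and>
        BWT T (run_head T (fst (wt_select M x i))) = x \<and>
        run_rank T x (fst (wt_select M x i)) = i \<and>
        snd (wt_select M x i) \<le> c * lg (length T)) \<and>
     (\<forall>a < length T. \<forall>b < length T.
        fst (lce_query M a b) = LCE T a b \<and>
        snd (lce_query M a b) \<le> c * lg (length T))"


section \<open>Word RAM\<close>

text \<open>A structured unit-cost word RAM with words of \<open>w\<close> bits. Registers and arrays are named by
  literals occurring in the program, so a program only has access to constantly many of them.
  The working memory consists of writable arrays indexed by words. Programs may in addition read
  the arrays of a static data structure and query the components of MONI.\<close>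

datatype binop =
  Plus | Minus | Times | Div | Mod | And | Or | Xor | Shl | Shr | Eq | Less

datatype expr = Const nat | Reg nat | Op binop expr expr

datatype com =
    Skip
  | Assign nat expr
  | Load nat nat expr         \<comment> \<open>register, working array, index\<close>
  | Store nat expr expr       \<comment> \<open>working array, index, value\<close>
  | Data nat nat expr         \<comment> \<open>register, array of the static data structure, index\<close>
  | Table nat column expr
  | Access nat expr
  | Rank nat expr expr
  | Select nat expr expr
  | Lce nat expr expr
  | Seq com com  (infixr \<open>;;\<close> 60)
  | Cond expr com com
  | While expr com

record state =
  regs :: "nat \<Rightarrow> nat"
  mem :: "nat \<Rightarrow> nat \<Rightarrow> nat"

fun apply_op :: "nat \<Rightarrow> binop \<Rightarrow> nat \<Rightarrow> nat \<Rightarrow> nat" where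
  "apply_op w Plus a b = (a + b) mod 2 ^ w"
| "apply_op w Minus a b = (a + (2 ^ w - b)) mod 2 ^ w"
| "apply_op w Times a b = (a * b) mod 2 ^ w"
| "apply_op w Div a b = a div b"
| "apply_op w Mod a b = a mod b"
| "apply_op w And a b = Bit_Operations.and a b"
| "apply_op w Or a b = Bit_Operations.or a b"
| "apply_op w Xor a b = Bit_Operations.xor a b"
| "apply_op w Shl a b = push_bit b a mod 2 ^ w"
| "apply_op w Shr a b = drop_bit b a"
| "apply_op w Eq a b = (if a = b then 1 else 0)"
| "apply_op w Less a b = (if a < b then 1 else 0)"

fun eval :: "nat \<Rightarrow> expr \<Rightarrow> state \<Rightarrow> nat" where
  "eval w (Const v) s = v mod 2 ^ w"
| "eval w (Reg x) s = regs s x"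
| "eval w (Op f e1 e2) s = apply_op w f (eval w e1 s) (eval w e2 s)"

fun cost :: "expr \<Rightarrow> nat" where
  "cost (Const v) = 1"
| "cost (Reg x) = 1"
| "cost (Op f e1 e2) = 1 + cost e1 + cost e2"

definition set_reg :: "nat \<Rightarrow> nat \<Rightarrow> nat \<Rightarrow> state \<Rightarrow> state" where
  "set_reg w x v s = s\<lparr>regs := (regs s)(x := v mod 2 ^ w)\<rparr>"

definition set_mem :: "nat \<Rightarrow> nat \<Rightarrow> nat \<Rightarrow> state \<Rightarrow> state" where
  "set_mem a i v s = s\<lparr>mem := (mem s)(a := (mem s a)(i := v))\<rparr>"

text \<open>\<open>exec w M D c s t s'\<close>: started in \<open>s\<close>, the program \<open>c\<close> terminates in \<open>s'\<close> after time \<open>t\<close>.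
  Reading a static array outside its bounds faults, that is, there is no such \<open>t\<close> and \<open>s'\<close>.\<close>

inductive exec :: "nat \<Rightarrow> moni \<Rightarrow> nat list list \<Rightarrow> com \<Rightarrow> state \<Rightarrow> nat \<Rightarrow> state \<Rightarrow> bool"
  for w :: nat and M :: moni and D :: "nat list list" where
  Skip: "exec w M D Skip s 1 s"
| Assign: "exec w M D (Assign x e) s (1 + cost e) (set_reg w x (eval w e s) s)"
| Load: "exec w M D (Load x a e) s (1 + cost e) (set_reg w x (mem s a (eval w e s)) s)"
| Store: "exec w M D (Store a e1 e2) s (1 + cost e1 + cost e2)
            (set_mem a (eval w e1 s) (eval w e2 s) s)"
| Data: "a < length D \<Longrightarrow> eval w e s < length (D ! a) \<Longrightarrow>
           exec w M D (Data x a e) s (1 + cost e) (set_reg w x (D ! a ! eval w e s) s)"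
| Table: "eval w e s < length (table M col) \<Longrightarrow>
           exec w M D (Table x col e) s (1 + cost e)
             (set_reg w x (table M col ! eval w e s) s)"
| Access: "wt_access M (eval w e s) = (v, t) \<Longrightarrow>
           exec w M D (Access x e) s (1 + cost e + t) (set_reg w x v s)"
| Rank: "wt_rank M (eval w e1 s) (eval w e2 s) = (v, t) \<Longrightarrow>
           exec w M D (Rank x e1 e2) s (1 + cost e1 + cost e2 + t) (set_reg w x v s)"
| Select: "wt_select M (eval w e1 s) (eval w e2 s) = (v, t) \<Longrightarrow>
           exec w M D (Select x e1 e2) s (1 + cost e1 + cost e2 + t) (set_reg w x v s)"
| Lce: "lce_query M (eval w e1 s) (eval w e2 s) = (v, t) \<Longrightarrow>
           exec w M D (Lce x e1 e2) s (1 + cost e1 + cost e2 + t) (set_reg w x v s)"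
| Seq: "exec w M D c1 s t1 s' \<Longrightarrow> exec w M D c2 s' t2 s'' \<Longrightarrow>
           exec w M D (c1 ;; c2) s (t1 + t2) s''"
| CondTrue: "eval w e s \<noteq> 0 \<Longrightarrow> exec w M D c1 s t s' \<Longrightarrow>
           exec w M D (Cond e c1 c2) s (1 + cost e + t) s'"
| CondFalse: "eval w e s = 0 \<Longrightarrow> exec w M D c2 s t s' \<Longrightarrow>
           exec w M D (Cond e c1 c2) s (1 + cost e + t) s'"
| WhileFalse: "eval w e s = 0 \<Longrightarrow> exec w M D (While e c) s (1 + cost e) s"
| WhileTrue: "eval w e s \<noteq> 0 \<Longrightarrow> exec w M D c s t1 s' \<Longrightarrow>
           exec w M D (While e c) s' t2 s'' \<Longrightarrow>
           exec w M D (While e c) s (1 + cost e + t1 + t2) s''"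

text \<open>Since execution is deterministic, \<open>exec\<close> expresses total correctness and its time index
  is the running time.\<close>

lemma exec_deterministic:
  "exec w M D c s t s' \<Longrightarrow> exec w M D c s u s'' \<Longrightarrow> u = t \<and> s'' = s'"
proof (induction arbitrary: u s'' rule: exec.induct)
  case (Seq c1 s t1 s' c2 t2 s'')
  from Seq.prems show ?case by (cases rule: exec.cases) (auto dest: Seq.IH)
next
  case (CondTrue e s c1 t s' c2)
  from CondTrue.prems show ?case
    by (cases rule: exec.cases) (use CondTrue.hyps in \<open>auto dest: CondTrue.IH\<close>)
next
  case (CondFalse e s c2 t s' c1)
  from CondFalse.prems show ?case
    by (cases rule: exec.cases) (use CondFalse.hyps in \<open>auto dest: CondFalse.IH\<close>)
next
  case (WhileTrue e s c t1 s' t2 s'')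
  from WhileTrue.prems show ?case
    by (cases rule: exec.cases) (use WhileTrue.hyps in \<open>auto dest: WhileTrue.IH\<close>)
qed (erule exec.cases; simp)+

text \<open>A static data structure is a sequence of arrays of \<open>w\<close>-bit words.\<close>

definition fits_words :: "nat \<Rightarrow> nat list list \<Rightarrow> bool" where
  "fits_words w D \<longleftrightarrow> (\<forall>A \<in> set D. \<forall>v \<in> set A. v < 2 ^ w)"

definition size_in_bits :: "nat \<Rightarrow> nat list list \<Rightarrow> nat" where
  "size_in_bits w D = w * sum_list (map length D)"


section \<open>Finding k-MEMs online\<close>

text \<open>Register 0 initially holds \<open>k\<close> (the largest word if \<open>k\<close> does not fit into a word, which is
  harmless as that is then larger than the length of the text), register 1 receives the characters
  of the pattern, and register 2 is the output.\<close>

definition start :: "nat \<Rightarrow> nat \<Rightarrow> state" where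
  "start w k = \<lparr>regs = (\<lambda>_. 0)(0 := min k (2 ^ w - 1)), mem = (\<lambda>_ _. 0)\<rparr>"

definition feed :: "nat \<Rightarrow> state \<Rightarrow> state" where
  "feed x s = s\<lparr>regs := (regs s)(1 := x)\<rparr>"

text \<open>A k-MEM starting at a given position is reported by its length, and the absence of one by 0:
  an online algorithm does not know the length of the pattern, and hence its own position in it.\<close>

definition reports :: "nat \<Rightarrow> str \<Rightarrow> str \<Rightarrow> nat \<Rightarrow> state \<Rightarrow> bool" where
  "reports k P T i s \<longleftrightarrow> (\<forall>j. is_kmem k P T i j \<longleftrightarrow> 0 < regs s 2 \<and> j + 1 = i + regs s 2)"

text \<open>The program \<open>init\<close> is run before the first character, \<open>step\<close> once for each character from
  right to left, and \<open>fin\<close> after the last one. Here \<open>s i\<close> is the state after \<open>P[i]\<close> has been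
  processed; it reports on position \<open>i + 1\<close>. Every phase takes time at most \<open>B\<close>, and all phases
  together take time at most \<open>B\<close> times the length of the pattern.\<close>

definition finds_kmems_online ::
  "nat \<Rightarrow> moni \<Rightarrow> nat list list \<Rightarrow> com \<Rightarrow> com \<Rightarrow> com \<Rightarrow> str \<Rightarrow> nat \<Rightarrow> str \<Rightarrow> nat \<Rightarrow> bool" where
  "finds_kmems_online w M D init step fin T k P B \<longleftrightarrow>
     (\<exists>s t t_init t_fin s_fin.
        exec w M D init (start w k) t_init (s (length P)) \<and> t_init \<le> B \<and>
        (\<forall>i < length P.
           exec w M D step (feed (P ! i) (s (i + 1))) (t i) (s i) \<and> t i \<le> B \<and>
           (i + 1 < length P \<longrightarrow> reports k P T (i + 1) (s i))) \<and>
        exec w M D fin (s 0) t_fin s_fin \<and> t_fin \<le> B \<and> reports k P T 0 s_fin \<and>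
        (P \<noteq> [] \<longrightarrow> t_init + (\<Sum>i<length P. t i) + t_fin \<le> B * length P))"

end

theory Submission
  imports Defs
begin

text \<open>
  Let \<open>ms k S\<close> be the length of the longest prefix of \<open>S\<close> with at least \<open>k\<close> occurrences in \<open>T\<close>.
  A \<open>k\<close>-MEM starts at \<open>i\<close> iff \<open>ms k P[i..]\<close> is positive and, for \<open>i > 0\<close>, at least
  \<open>ms k P[i-1..]\<close>; then this is its length. So it suffices to compute \<open>ms k P[i..]\<close> for decreasing \<open>i\<close>.

  As in MONI, we maintain a row \<open>q\<close> of the suffix array whose suffix has the longest common prefix
  with \<open>S = P[i..]\<close>, and the length \<open>l\<close> of that prefix. Then every row \<open>t\<close> matches \<open>S\<close> to length
  \<open>min l (LCE (SA[q], SA[t]))\<close>, which decreases with the distance from \<open>q\<close>. Hence a best row for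
  \<open>x # S\<close> is the \<open>LF\<close>-image of the nearest row above or below \<open>q\<close> whose BWT symbol is \<open>x\<close>. Moreover
  \<open>k\<close> rows that match \<open>S\<close> best are obtained by extending the window \<open>{q}\<close> greedily \<open>k - 1\<close> times by
  the better one of its two neighbours; the worst match in the window is \<open>ms k S\<close>.

  The text positions of the neighbours come from the maps \<open>SA[t] \<mapsto> SA[t - 1]\<close> and
  \<open>SA[t] \<mapsto> SA[t + 1]\<close>, which act as translations between consecutive sampled positions at run boundaries. They are thus evaluated
  by binary search in \<open>O(r)\<close> stored words, and so is the run that contains a row.
\<close>

section \<open>Suffix arrays and runs\<close>

fun lcp :: "'a list \<Rightarrow> 'a list \<Rightarrow> nat" where
  "lcp (x # xs) (y # ys) = (if x = y then Suc (lcp xs ys) else 0)"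
| "lcp _ _ = 0"

lemma le_lcp_iff:
  "l \<le> lcp xs ys \<longleftrightarrow> l \<le> length xs \<and> l \<le> length ys \<and> take l xs = take l ys"
proof (induction xs ys arbitrary: l rule: lcp.induct)
  case (1 x xs y ys)
  then show ?case by (cases l) auto
qed auto

lemma lcp_commute: "lcp xs ys = lcp ys xs"
  by (induction xs ys rule: lcp.induct) auto

lemma lcp_le_length: "lcp xs ys \<le> length xs" "lcp xs ys \<le> length ys"
  using le_lcp_iff[of "lcp xs ys" xs ys] by auto

lemma lcp_Nil [simp]: "lcp [] ys = 0" "lcp xs [] = 0"
  by (cases xs; simp)+

lemma LCE_eq_lcp: "LCE T a b = lcp (drop a T) (drop b T)"
proof -
  have "{l. l \<le> length T - a \<and> l \<le> length T - b \<and> take l (drop a T) = take l (drop b T)}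
      = {..lcp (drop a T) (drop b T)}"
    by (auto simp: le_lcp_iff)
  moreover have "Max {..lcp (drop a T) (drop b T)} = lcp (drop a T) (drop b T)"
    by (intro Max_eqI) auto
  ultimately show ?thesis by (simp add: LCE_def)
qed

text \<open>The ultrametric inequality: a prefix length shared by both pairs is shared by all three
  lists.\<close>

lemma lcp_min: "min (lcp xs ys) (lcp ys zs) \<le> lcp xs zs"
proof -
  let ?m = "min (lcp xs ys) (lcp ys zs)"
  have "?m \<le> lcp xs ys" "?m \<le> lcp ys zs" by simp_all
  then show ?thesis unfolding le_lcp_iff by simp
qed

text \<open>By the ultrametric inequality the smallest of the three pairwise values occurs at least
  twice. This is what replaces a comparison with the pattern by an LCE query between two text
  positions.\<close>

lemma lcp_best:
  assumes "lcp S ys \<le> lcp S xs"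
  shows "lcp S ys = min (lcp S xs) (lcp xs ys)"
  using lcp_min[of S xs ys] lcp_min[of S ys xs] lcp_min[of xs S ys]
    lcp_commute[of ys xs] lcp_commute[of xs S] assms by linarith

lemma take_mono_lexord:
  fixes xs ys :: "'a::linorder list"
  shows "xs \<le> ys \<Longrightarrow> take l xs \<le> take l ys"
proof (induction l arbitrary: xs ys)
  case (Suc l)
  then show ?case by (cases xs; cases ys) auto
qed simp

text \<open>Truncated to \<open>lcp xs zs\<close>, the outer lists coincide, and truncation
  preserves the order, so the middle list is squeezed between equal prefixes.\<close>

lemma lcp_mono_lexord:
  fixes xs ys zs :: "'a::linorder list"
  assumes "xs \<le> ys" "ys \<le> zs"
  shows "lcp xs zs \<le> lcp xs ys" "lcp xs zs \<le> lcp ys zs"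
proof -
  let ?l = "lcp xs zs"
  have l: "?l \<le> length xs" "?l \<le> length zs" "take ?l xs = take ?l zs"
    using le_lcp_iff[of ?l xs zs] by auto
  then have *: "take ?l xs = take ?l ys"
    using take_mono_lexord[of xs ys ?l] take_mono_lexord[of ys zs ?l] assms by simp
  then have "?l \<le> length ys"
    using l(1) by (metis length_take min.absorb2 min.cobounded1)
  then show "?l \<le> lcp xs ys" "?l \<le> lcp ys zs"
    using l * by (auto simp: le_lcp_iff)
qed

lemma nth_sorted_list_of_set_mono:
  fixes A :: "'a::linorder set"
  assumes "finite A" "i < j" "j < card A"
  shows "sorted_list_of_set A ! i < sorted_list_of_set A ! j"
  using assms strict_sorted_list_of_set[of A]
  by (simp add: sorted_wrt_iff_nth_less)

section \<open>Rows, text positions and the LF mapping\<close>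

locale indexed_text =
  fixes T :: str
  assumes is_text: "is_text T"
begin

abbreviation n where "n \<equiv> length T"
abbreviation r where "r \<equiv> num_runs T"
abbreviation sa where "sa q \<equiv> SA T ! q"
abbreviation suf where "suf q \<equiv> drop (SA T ! q) T"
abbreviation bwt where "bwt \<equiv> BWT T"
abbreviation hd_run where "hd_run \<equiv> run_head T"
abbreviation tl_run where "tl_run \<equiv> run_tail T"

lemma n_pos: "0 < n"
  using is_text by (auto simp: is_text_def)

lemma last_less: "i < n - 1 \<Longrightarrow> T ! (n - 1) < T ! i"
proof -
  assume "i < n - 1"
  then have "T ! i \<in> set (butlast T)"
    by (metis length_butlast nth_butlast nth_mem)
  then show ?thesis
    using is_text n_pos by (auto simp: is_text_def last_conv_nth)
qed

lemma length_SA [simp]: "length (SA T) = n"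
  by (simp add: SA_def)

lemma set_SA: "set (SA T) = {..<n}"
  by (auto simp: SA_def)

lemma distinct_SA: "distinct (SA T)"
  by (simp add: SA_def)

lemma sa_less: "q < n \<Longrightarrow> sa q < n"
  using set_SA by (metis length_SA lessThan_iff nth_mem)

lemma sa_eq_iff: "q < n \<Longrightarrow> q' < n \<Longrightarrow> sa q = sa q' \<longleftrightarrow> q = q'"
  using distinct_SA by (simp add: nth_eq_iff_index_eq)

lemma ex_row: "p < n \<Longrightarrow> \<exists>q<n. sa q = p"
  using set_SA by (metis in_set_conv_nth length_SA lessThan_iff)

lemma bij_betw_sa: "bij_betw sa {..<n} {..<n}"
  using distinct_SA set_SA bij_betw_nth[of "SA T" "{..<n}"] by simp

lemma suf_eq_iff: "q < n \<Longrightarrow> q' < n \<Longrightarrow> suf q = suf q' \<longleftrightarrow> q = q'"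
proof
  assume q: "q < n" "q' < n" and "suf q = suf q'"
  then have "n - sa q = n - sa q'" by (metis length_drop)
  then have "sa q = sa q'" using q sa_less[of q] sa_less[of q'] by linarith
  then show "q = q'" using q sa_eq_iff by blast
qed simp

lemma suf_mono: "q \<le> q' \<Longrightarrow> q' < n \<Longrightarrow> suf q \<le> suf q'"
proof -
  assume "q \<le> q'" "q' < n"
  moreover have "sorted (map (\<lambda>p. drop p T) (SA T))"
    by (simp add: SA_def)
  ultimately show ?thesis
    by (auto simp: sorted_iff_nth_mono)
qed

lemma suf_less_iff: "q < n \<Longrightarrow> q' < n \<Longrightarrow> suf q < suf q' \<longleftrightarrow> q < q'"
  using suf_mono[of q q'] suf_mono[of q' q] suf_eq_iff[of q q']
  by (metis linorder_not_less nless_le order_less_le)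

text \<open>Every other suffix begins with a symbol larger than the terminator. This gives the
  starting row its text position without a lookup.\<close>

lemma sa_0: "sa 0 = n - 1"
proof (rule ccontr)
  assume *: "sa 0 \<noteq> n - 1"
  obtain q where q: "q < n" "sa q = n - 1" using ex_row[of "n - 1"] n_pos by auto
  have "q \<noteq> 0" using * q(2) by (metis)
  then have less: "suf 0 < suf q" using suf_less_iff[of 0 q] n_pos q(1) by blast
  have "suf q = [T ! (n - 1)]"
    using q n_pos Cons_nth_drop_Suc[of "n - 1" T] by simp
  moreover have "suf 0 = T ! sa 0 # drop (Suc (sa 0)) T"
    using sa_less[of 0] n_pos by (simp add: Cons_nth_drop_Suc)
  moreover have "T ! (n - 1) < T ! sa 0"
    using last_less[of "sa 0"] sa_less[of 0] n_pos * by linarith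
  ultimately show False using less by simp
qed

lemma prev_pos_eq: "p < n \<Longrightarrow> prev_pos T p = (if p = 0 then n - 1 else p - 1)"
  by (auto simp: prev_pos_def mod_if)

lemma prev_pos_less: "prev_pos T p < n"
  using n_pos by (simp add: prev_pos_def)

lemma ex_next:
  assumes "q < n"
  shows "\<exists>t<n. prev_pos T (sa t) = sa q"
proof -
  let ?p = "if sa q = n - 1 then 0 else Suc (sa q)"
  have "?p < n" using sa_less[OF assms] n_pos by auto
  moreover have "prev_pos T ?p = sa q"
    using sa_less[OF assms] n_pos by (simp add: prev_pos_eq)
  ultimately show ?thesis using ex_row by metis
qed

lemma LF_less: "q < n \<Longrightarrow> LF T q < n"
  and sa_LF: "q < n \<Longrightarrow> sa (LF T q) = prev_pos T (sa q)"
proof -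
  have "\<exists>!q'. q' < n \<and> sa q' = prev_pos T (sa q)"
    using ex_row[OF prev_pos_less] sa_eq_iff by metis
  from theI'[OF this] show "LF T q < n" "sa (LF T q) = prev_pos T (sa q)"
    by (auto simp: LF_def)
qed

lemma BWT_eq_last_iff: "q < n \<Longrightarrow> bwt q = T ! (n - 1) \<longleftrightarrow> sa q = 0"
proof -
  assume q: "q < n"
  show ?thesis
  proof (cases "sa q = 0")
    case False
    then have "sa q - 1 < n - 1" using sa_less[OF q] by linarith
    then show ?thesis using last_less[of "sa q - 1"] False sa_less[OF q]
      by (simp add: BWT_def prev_pos_eq)
  qed (use q n_pos in \<open>simp add: BWT_def prev_pos_eq\<close>)
qed

text \<open>The terminator occurs only once in the BWT, so rows that share a symbol avoid text
  position 0, where \<open>LF\<close> wraps around.\<close>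

lemma same_BWT_pos:
  assumes "q < n" "q' < n" "bwt q = bwt q'" "q \<noteq> q'"
  shows "0 < sa q"
  using BWT_eq_last_iff[of q] BWT_eq_last_iff[of q'] sa_eq_iff[of q q'] assms
  by force

lemma suf_LF: "q < n \<Longrightarrow> 0 < sa q \<Longrightarrow> suf (LF T q) = bwt q # suf q"
  using sa_less[of q] sa_LF[of q] Cons_nth_drop_Suc[of "sa q - 1" T]
  by (simp add: prev_pos_eq BWT_def)

text \<open>Prepending a common symbol preserves the order. A row strictly between the two images
  would begin with that symbol too, and removing it would give a row strictly between
  \<open>q\<close> and \<open>Suc q\<close>.\<close>

lemma LF_Suc:
  assumes "Suc q < n" "bwt q = bwt (Suc q)"
  shows "LF T (Suc q) = Suc (LF T q)"
proof -
  have pos: "0 < sa q" "0 < sa (Suc q)"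
    using same_BWT_pos[of q "Suc q"] same_BWT_pos[of "Suc q" q] assms by auto
  have sufs: "suf (LF T q) = bwt q # suf q" "suf (LF T (Suc q)) = bwt q # suf (Suc q)"
    using suf_LF pos assms by auto
  have "suf q < suf (Suc q)" using assms suf_less_iff by simp
  then have "suf (LF T q) < suf (LF T (Suc q))" using sufs by simp
  then have less: "LF T q < LF T (Suc q)" using suf_less_iff LF_less assms by simp
  have "\<not> Suc (LF T q) < LF T (Suc q)"
  proof
    define u where "u = Suc (LF T q)"
    assume "Suc (LF T q) < LF T (Suc q)"
    then have u: "u < n" "u < LF T (Suc q)" "LF T q < u"
      using LF_less[of "Suc q"] assms by (auto simp: u_def)
    then have between: "bwt q # suf q < suf u" "suf u < bwt q # suf (Suc q)"
      using suf_less_iff[of "LF T q" u] suf_less_iff[of u "LF T (Suc q)"] sufs assms LF_less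
      by auto
    have "suf u = T ! sa u # drop (Suc (sa u)) T"
      using sa_less[of u] u by (simp add: Cons_nth_drop_Suc)
    then have betw: "suf q < drop (Suc (sa u)) T" "drop (Suc (sa u)) T < suf (Suc q)"
      using between by auto
    \<comment> \<open>The remaining suffix exceeds another list, so it is nonempty and thus has a
      row of its own.\<close>
    then have "Suc (sa u) < n"
      by (metis drop_eq_Nil2 linorder_not_less not_less_Nil)
    then obtain t where t: "t < n" "sa t = Suc (sa u)" using ex_row by blast
    then have "q < t" "t < Suc q"
      using betw suf_less_iff[of q t] suf_less_iff[of t "Suc q"] assms by auto
    then show False by simp
  qed
  then show ?thesis using less by linarith
qed

section \<open>Runs of the BWT\<close>

lemma is_runD:
  assumes "is_run T a b"
  shows "a \<le> b" "b < n" "\<And>q. a \<le> q \<Longrightarrow> q \<le> b \<Longrightarrow> bwt q = bwt a"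
    "a = 0 \<or> bwt (a - 1) \<noteq> bwt a" "b = n - 1 \<or> bwt (b + 1) \<noteq> bwt b"
  using assms unfolding is_run_def by (blast, blast, meson atLeastAtMost_iff, blast, blast)

lemma is_run_unique: "is_run T a b \<Longrightarrow> is_run T a b' \<Longrightarrow> b = b'"
proof -
  have False if ab: "is_run T a b" and ab': "is_run T a b'" and less: "b < b'" for b b'
  proof -
    have "bwt (b + 1) = bwt b"
      using is_runD(3)[OF ab', of "b + 1"] is_runD(3)[OF ab, of b] is_runD(1)[OF ab] less
      by simp
    moreover have "b \<noteq> n - 1" using is_runD(2)[OF ab'] less by linarith
    ultimately show False using is_runD(5)[OF ab] by blast
  qed
  then show "is_run T a b \<Longrightarrow> is_run T a b' \<Longrightarrow> b = b'" by (metis linorder_neqE_nat)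
qed

definition heads where "heads = {a. \<exists>b. is_run T a b}"

text \<open>A position where the symbol changes does start a run: the run ends at the last
  \<open>b\<close> up to which the symbol stays constant.\<close>

lemma heads_eq: "heads = {a. a < n \<and> (a = 0 \<or> bwt (a - 1) \<noteq> bwt a)}"
proof -
  have "\<exists>b. is_run T a b" if a: "a < n" "a = 0 \<or> bwt (a - 1) \<noteq> bwt a" for a
  proof -
    let ?B = "{b. a \<le> b \<and> b < n \<and> (\<forall>q\<in>{a..b}. bwt q = bwt a)}"
    define b where "b = Max ?B"
    have fin: "finite ?B" by simp
    have "a \<in> ?B" using a by auto
    then have "b \<in> ?B" unfolding b_def using Max_in fin by blast
    then have b: "a \<le> b" "b < n" "\<forall>q\<in>{a..b}. bwt q = bwt a" by blast+
    have "bwt b = bwt a" using b(1) b(3)[rule_format, of b] by simp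
    have "b + 1 < n \<Longrightarrow> bwt (b + 1) \<noteq> bwt b"
    proof
      assume *: "b + 1 < n" "bwt (b + 1) = bwt b"
      have "bwt q = bwt a" if "q \<in> {a..b + 1}" for q
      proof (cases "q = b + 1")
        case True
        then show ?thesis using * \<open>bwt b = bwt a\<close> by metis
      next
        case False
        then have "q \<in> {a..b}" using that by auto
        then show ?thesis using b(3) by blast
      qed
      then have "b + 1 \<in> ?B" using b(1) *(1) le_add1[of b 1] by (blast intro: le_trans)
      then show False using Max_ge[OF fin, of "b + 1"] b_def by linarith
    qed
    moreover have "b + 1 < n \<or> b = n - 1" using b(2) by linarith
    ultimately have "is_run T a b" using a b unfolding is_run_def by blast
    then show ?thesis by blast
  qed
  moreover have "a < n" "a = 0 \<or> bwt (a - 1) \<noteq> bwt a" if "is_run T a b" for a b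
    using is_runD[OF that] by linarith+
  ultimately show ?thesis unfolding heads_def by blast
qed

lemma finite_heads [simp]: "finite heads"
  by (simp add: heads_eq)

lemma card_heads: "card heads = r"
proof -
  have "heads = fst ` {(a, b). is_run T a b}" by (force simp: heads_def)
  moreover have "inj_on fst {(a, b). is_run T a b}"
    by (auto simp: inj_on_def dest: is_run_unique)
  ultimately show ?thesis by (simp add: num_runs_def card_image)
qed

lemma r_le_n: "r \<le> n"
proof -
  have "card heads \<le> card {..<n}" by (rule card_mono) (auto simp: heads_eq)
  then show ?thesis by (simp add: card_heads)
qed

lemma r_pos: "0 < r"
proof -
  have "0 \<in> heads" using n_pos by (auto simp: heads_eq)
  then show ?thesis using card_heads card_gt_0_iff[of heads] by auto
qed

lemma hd_run_eq: "hd_run j = sorted_list_of_set heads ! j"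
  by (simp add: run_head_def heads_def)

lemma hd_run_mono: "i < j \<Longrightarrow> j < r \<Longrightarrow> hd_run i < hd_run j"
  by (simp add: hd_run_eq nth_sorted_list_of_set_mono card_heads)

lemma heads_image: "heads = hd_run ` {..<r}"
proof -
  have "heads = set (sorted_list_of_set heads)" by simp
  also have "\<dots> = hd_run ` {..<r}"
    by (auto simp: in_set_conv_nth hd_run_eq card_heads image_iff Bex_def
             simp del: set_sorted_list_of_set)
  finally show ?thesis .
qed

lemma is_run_hd_tl: "j < r \<Longrightarrow> is_run T (hd_run j) (tl_run j)"
proof -
  assume "j < r"
  then have "hd_run j \<in> heads" by (simp add: heads_image)
  then obtain b where "is_run T (hd_run j) b" by (auto simp: heads_def)
  then have "\<exists>!b. is_run T (hd_run j) b" using is_run_unique by blast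
  then show ?thesis unfolding run_tail_def by (rule theI')
qed

lemma
  assumes "j < r"
  shows hd_run_less: "hd_run j < n" and tl_run_less: "tl_run j < n"
    and hd_le_tl: "hd_run j \<le> tl_run j"
    and BWT_run: "hd_run j \<le> q \<Longrightarrow> q \<le> tl_run j \<Longrightarrow> bwt q = bwt (hd_run j)"
proof -
  note run = is_runD[OF is_run_hd_tl[OF assms]]
  show "hd_run j < n" using run(1,2) by linarith
  show "tl_run j < n" "hd_run j \<le> tl_run j" by (fact run)+
  show "bwt q = bwt (hd_run j)" if "hd_run j \<le> q" "q \<le> tl_run j" using run(3) that by blast
qed

lemma tl_less_hd: "i < j \<Longrightarrow> j < r \<Longrightarrow> tl_run i < hd_run j"
proof (rule ccontr)
  assume ij: "i < j" "j < r" "\<not> tl_run i < hd_run j"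
  then have *: "hd_run i < hd_run j" using hd_run_mono by blast
  have "i < r" using ij by linarith
  then have "bwt (hd_run j) = bwt (hd_run i)" "bwt (hd_run j - 1) = bwt (hd_run i)"
    by (rule BWT_run; use ij * in linarith)+
  moreover have "hd_run j \<noteq> 0" using * by linarith
  ultimately show False using is_runD(4)[OF is_run_hd_tl[OF ij(2)]] by argo
qed

text \<open>Take the largest head up to \<open>q\<close>. If its run ended before \<open>q\<close>,
  the row after its tail would be a larger head.\<close>

lemma run_exists:
  assumes "q < n"
  shows "\<exists>j<r. hd_run j \<le> q \<and> q \<le> tl_run j"
proof -
  let ?A = "{a \<in> heads. a \<le> q}"
  define a where "a = Max ?A"
  have "0 \<in> ?A" using n_pos by (auto simp: heads_eq)
  moreover have fin: "finite ?A" by simp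
  ultimately have a: "a \<in> ?A" unfolding a_def using Max_in[of ?A] by blast
  then obtain j where j: "j < r" "a = hd_run j" by (auto simp: heads_image)
  have "q \<le> tl_run j"
  proof (rule ccontr)
    assume *: "\<not> q \<le> tl_run j"
    then have "tl_run j \<noteq> n - 1" "tl_run j + 1 < n" using assms by linarith+
    then have "tl_run j + 1 \<in> heads"
      using is_runD(5)[OF is_run_hd_tl[OF j(1)]] unfolding heads_eq by simp
    then have "tl_run j + 1 \<in> ?A" using * by simp
    then have "tl_run j + 1 \<le> a" unfolding a_def using Max_ge[OF fin] by blast
    then show False using hd_le_tl[OF j(1)] j(2) by linarith
  qed
  then show ?thesis using a j by auto
qed

text \<open>Translates the outcome of a binary search over the heads into membership in a
  run.\<close>

lemma run_of_row:
  assumes "q < n" "j < r" "hd_run j \<le> q" "Suc j < r \<Longrightarrow> q < hd_run (Suc j)"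
  shows "q \<le> tl_run j"
proof -
  obtain i where i: "i < r" "hd_run i \<le> q" "q \<le> tl_run i" using run_exists assms by blast
  have "i \<le> j"
  proof (rule ccontr)
    assume "\<not> i \<le> j"
    then have "Suc j \<le> i" "Suc j < r" using i by auto
    then have "hd_run (Suc j) \<le> hd_run i"
      using hd_run_mono[of "Suc j" i] i by (cases "Suc j = i") auto
    then show False using assms(4) \<open>Suc j < r\<close> i by simp
  qed
  moreover have "\<not> i < j" using tl_less_hd[of i j] assms i by auto
  ultimately show ?thesis using i by simp
qed

lemma run_le:
  assumes "i < r" "j < r" "hd_run i \<le> t" "t \<le> q" "q \<le> tl_run j"
  shows "i \<le> j"
proof (rule ccontr)
  assume "\<not> i \<le> j"
  then have "tl_run j < hd_run i" using tl_less_hd assms by simp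
  then show False using assms by linarith
qed

text \<open>Iterating \<open>LF_Suc\<close> shows that \<open>LF\<close> is a translation on each
  run, so one stored value per run determines it.\<close>

lemma LF_run:
  assumes "j < r" "hd_run j \<le> q" "q \<le> tl_run j"
  shows "LF T q = LF T (hd_run j) + (q - hd_run j)"
proof -
  have "hd_run j + d \<le> tl_run j \<Longrightarrow> LF T (hd_run j + d) = LF T (hd_run j) + d" for d
  proof (induction d)
    case (Suc d)
    then show ?case
      using LF_Suc[of "hd_run j + d"] BWT_run[of j "hd_run j + d"] BWT_run[of j "hd_run j + Suc d"]
        assms tl_run_less[of j] by simp
  qed simp
  from this[of "q - hd_run j"] show ?thesis using assms by simp
qed

section \<open>Sampled rows and the text positions of neighbouring rows\<close>

definition tails where "tails = tl_run ` {..<r}"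

lemma tl_run_mono: "i < j \<Longrightarrow> j < r \<Longrightarrow> tl_run i < tl_run j"
  using tl_less_hd hd_le_tl by (meson less_le_trans)

lemma inj_on_tl_run: "inj_on tl_run {..<r}"
  by (rule linorder_inj_onI') (use tl_run_mono in fastforce)

lemma tails_less: "q \<in> tails \<Longrightarrow> q < n" and heads_less: "q \<in> heads \<Longrightarrow> q < n"
  using tl_run_less by (auto simp: tails_def heads_eq)

lemma finite_tails [simp]: "finite tails"
  by (simp add: tails_def)

lemma card_tails: "card tails = r"
  by (simp add: tails_def card_image inj_on_tl_run)

lemma not_head: "q < n \<Longrightarrow> q \<notin> heads \<Longrightarrow> 0 < q \<and> bwt (q - 1) = bwt q"
  by (auto simp: heads_eq)

lemma not_tail:
  assumes "q < n" "q \<notin> tails"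
  shows "Suc q < n \<and> bwt (Suc q) = bwt q"
proof -
  obtain j where j: "j < r" "hd_run j \<le> q" "q \<le> tl_run j" using run_exists assms by blast
  then have "q < tl_run j" using assms by (fastforce simp: tails_def nless_le)
  then show ?thesis using j tl_run_less[of j] BWT_run[of j q] BWT_run[of j "Suc q"] by auto
qed

text \<open>The inverse suffix array.\<close>

definition row where "row p = (THE q. q < n \<and> sa q = p)"

lemma row_sa [simp]: "q < n \<Longrightarrow> row (sa q) = q"
  unfolding row_def using sa_eq_iff by blast

text \<open>The row of text position 0 is alone in its run, because its BWT symbol is the
  terminator. Hence every text position has a sample at or before it.\<close>

lemma text_start_sampled:
  assumes "q < n" "sa q = 0"
  shows "q \<in> heads" "q \<in> tails"
proof -
  show "q \<in> heads"
    using same_BWT_pos[of q "q - 1"] not_head[of q] assms by fastforce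
  show "q \<in> tails"
    using same_BWT_pos[of q "Suc q"] not_tail[of q] assms by fastforce
qed

text \<open>Induction on the text position. If \<open>q\<close> is not a head, rows
  \<open>q - 1\<close> and \<open>q\<close> share their BWT symbol, so \<open>LF\<close> keeps them
  adjacent and lowers both text positions by one. The closest sample at or before the position stays
  the same until it is reached.\<close>

lemma phi_sample:
  assumes "q < n" "0 < q" "q' \<in> heads" "sa q' \<le> sa q"
    "\<And>h. h \<in> heads \<Longrightarrow> sa h \<le> sa q \<Longrightarrow> sa h \<le> sa q'"
  shows "sa (q - 1) = sa (q' - 1) + (sa q - sa q')"
  using assms
proof (induction "sa q" arbitrary: q)
  case 0
  then have "q = q'" using sa_eq_iff[of q q'] heads_less by auto
  then show ?case by simp
next
  case (Suc p)
  show ?case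
  proof (cases "q \<in> heads")
    case True
    then have "q = q'" using Suc.prems sa_eq_iff[of q q'] heads_less by (simp add: le_antisym)
    then show ?thesis by simp
  next
    case False
    then have bwt: "bwt (q - 1) = bwt q" using not_head Suc.prems by blast
    have pos: "0 < sa (q - 1)" using same_BWT_pos[of "q - 1" q] Suc.prems bwt by simp
    have LF: "LF T q = Suc (LF T (q - 1))" using LF_Suc[of "q - 1"] Suc.prems bwt by simp
    have p: "sa (LF T q) = p"
      using sa_LF[of q] Suc.prems Suc.hyps(2) sa_less by (simp add: prev_pos_eq)
    have "sa q' \<noteq> sa q" using False Suc.prems sa_eq_iff heads_less by blast
    then have le: "sa q' \<le> p" using Suc.prems Suc.hyps(2) by simp
    have "sa (LF T q - 1) = sa (q' - 1) + (sa (LF T q) - sa q')"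
    proof (rule Suc.hyps(1))
      show "sa h \<le> sa q'" if "h \<in> heads" "sa h \<le> sa (LF T q)" for h
        using Suc.prems(5)[OF that(1)] that p Suc.hyps(2) by simp
    qed (use p le LF_less[OF Suc.prems(1)] Suc.prems LF in simp_all)
    moreover have "sa (LF T q - 1) = sa (q - 1) - 1"
      using LF sa_LF[of "q - 1"] Suc.prems pos sa_less[of "q - 1"] by (simp add: prev_pos_eq)
    ultimately show ?thesis using p pos Suc.hyps(2) le by linarith
  qed
qed

text \<open>The mirror image of \<open>phi_sample\<close>, with tails. Its first conjunct guarantees
  that the sample is not the last row, so the entry stored for it is not the default.\<close>

lemma phi_inv_sample:
  assumes "Suc q < n" "q' \<in> tails" "sa q' \<le> sa q"
    "\<And>h. h \<in> tails \<Longrightarrow> sa h \<le> sa q \<Longrightarrow> sa h \<le> sa q'"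
  shows "Suc q' < n \<and> sa (Suc q) = sa (Suc q') + (sa q - sa q')"
  using assms
proof (induction "sa q" arbitrary: q)
  case 0
  then have "q = q'" using sa_eq_iff[of q q'] tails_less by auto
  then show ?case using 0 by simp
next
  case (Suc p)
  show ?case
  proof (cases "q \<in> tails")
    case True
    then have "q = q'" using Suc.prems sa_eq_iff[of q q'] tails_less by (simp add: le_antisym)
    then show ?thesis using Suc.prems by simp
  next
    case False
    then have bwt: "bwt (Suc q) = bwt q" using not_tail Suc.prems by simp
    have pos: "0 < sa (Suc q)" using same_BWT_pos[of "Suc q" q] Suc.prems bwt by simp
    have LF: "LF T (Suc q) = Suc (LF T q)" using LF_Suc[of q] Suc.prems bwt by simp
    have p: "sa (LF T q) = p"
      using sa_LF[of q] Suc.prems Suc.hyps(2) sa_less by (simp add: prev_pos_eq)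
    have "sa q' \<noteq> sa q" using False Suc.prems sa_eq_iff tails_less by (metis Suc_lessD)
    then have le: "sa q' \<le> p" using Suc.prems Suc.hyps(2) by simp
    have "Suc q' < n \<and> sa (Suc (LF T q)) = sa (Suc q') + (sa (LF T q) - sa q')"
    proof (rule Suc.hyps(1))
      show "sa h \<le> sa q'" if "h \<in> tails" "sa h \<le> sa (LF T q)" for h
        using Suc.prems(4)[OF that(1)] that p Suc.hyps(2) by simp
      show "Suc (LF T q) < n" using LF LF_less[of "Suc q"] Suc.prems by simp
    qed (use p le Suc.prems in auto)
    moreover have "sa (Suc (LF T q)) = sa (Suc q) - 1"
      using LF sa_LF[of "Suc q"] Suc.prems pos sa_less[of "Suc q"] by (simp add: prev_pos_eq)
    ultimately show ?thesis using p pos Suc.hyps(2) le by linarith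
  qed
qed

section \<open>Nearest runs with a given symbol\<close>

lemma run_rank_mono: "i \<le> j \<Longrightarrow> run_rank T x i \<le> run_rank T x j"
  unfolding run_rank_def by (rule card_mono) auto

lemma run_rank_Suc: "run_rank T x (Suc j) = run_rank T x j + (if bwt (hd_run j) = x then 1 else 0)"
proof -
  have "{i. i < Suc j \<and> bwt (hd_run i) = x} =
    {i. i < j \<and> bwt (hd_run i) = x} \<union> (if bwt (hd_run j) = x then {j} else {})"
    by (auto simp: less_Suc_eq)
  then show ?thesis by (auto simp: run_rank_def)
qed

lemma run_rank_less: "i < j \<Longrightarrow> bwt (hd_run i) = x \<Longrightarrow> run_rank T x i < run_rank T x j"
  using run_rank_mono[of "Suc i" j x] run_rank_Suc[of x i] by simp

text \<open>A run of \<open>x\<close> strictly between runs \<open>i\<close> and \<open>j\<close>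
  would make their ranks differ by at least two. Hence the tail of run \<open>i\<close> is the
  nearest row above \<open>q\<close> with symbol \<open>x\<close>.\<close>

lemma run_above:
  assumes j: "j < r" "hd_run j \<le> q" "q \<le> tl_run j" "bwt q \<noteq> x"
    and i: "i < r" "bwt (hd_run i) = x" "Suc (run_rank T x i) = run_rank T x j"
  shows "tl_run i < q" "\<And>t. t < q \<Longrightarrow> bwt t = x \<Longrightarrow> t \<le> tl_run i"
proof -
  have "\<not> j \<le> i" using run_rank_mono[of j i x] i by linarith
  then have "i < j" by simp
  then show "tl_run i < q" using tl_less_hd[of i j] j by simp
  show "t \<le> tl_run i" if t: "t < q" "bwt t = x" for t
  proof (rule ccontr)
    assume *: "\<not> t \<le> tl_run i"
    have "t < n" using t j tl_run_less[of j] by simp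
    then obtain i' where i': "i' < r" "hd_run i' \<le> t" "t \<le> tl_run i'" using run_exists by blast
    then have x: "bwt (hd_run i') = x" using BWT_run t by metis
    have "\<not> i' \<le> i"
      using tl_run_mono[of i' i] * i' i by (cases "i' = i") auto
    then have "i < i'" by simp
    moreover have "i' < j"
    proof -
      have "i' \<noteq> j" using x BWT_run[of j q] j by auto
      moreover have "i' \<le> j" using run_le[of i' j t q] i' j t by simp
      ultimately show ?thesis by simp
    qed
    ultimately show False
      using run_rank_less[of i i' x] run_rank_less[of i' j x] i x by simp
  qed
qed

lemma no_run_above:
  assumes j: "j < r" "hd_run j \<le> q" "q \<le> tl_run j" "bwt q \<noteq> x"
    and "run_rank T x j = 0" "t < q"
  shows "bwt t \<noteq> x"
proof
  assume t: "bwt t = x"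
  have "t < n" using assms tl_run_less[of j] by simp
  then obtain i' where i': "i' < r" "hd_run i' \<le> t" "t \<le> tl_run i'" using run_exists by blast
  then have x: "bwt (hd_run i') = x" using BWT_run t by metis
  have "i' \<noteq> j" using x BWT_run[of j q] j by auto
  moreover have "i' \<le> j" using run_le[of i' j t q] i' assms by simp
  ultimately show False using run_rank_less[of i' j x] x assms by simp
qed

text \<open>Run \<open>j\<close> does not carry \<open>x\<close>, so its rank agrees with that of
  the next run of \<open>x\<close>; another run of \<open>x\<close> in between would separate the
  two ranks.\<close>

lemma run_below:
  assumes j: "j < r" "hd_run j \<le> q" "q \<le> tl_run j" "bwt q \<noteq> x"
    and i: "i < r" "bwt (hd_run i) = x" "run_rank T x i = run_rank T x j"
  shows "q < hd_run i" "\<And>t. q < t \<Longrightarrow> t < n \<Longrightarrow> bwt t = x \<Longrightarrow> hd_run i \<le> t"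
proof -
  have "i \<noteq> j" using i BWT_run[of j q] j by auto
  moreover have "\<not> i < j" using run_rank_less[of i j x] i by auto
  ultimately have "j < i" by simp
  then show "q < hd_run i" using tl_less_hd[of j i] i j by simp
  show "hd_run i \<le> t" if t: "q < t" "t < n" "bwt t = x" for t
  proof (rule ccontr)
    assume *: "\<not> hd_run i \<le> t"
    obtain i' where i': "i' < r" "hd_run i' \<le> t" "t \<le> tl_run i'" using run_exists t by blast
    then have x: "bwt (hd_run i') = x" using BWT_run t by metis
    have "i' \<noteq> j" using x BWT_run[of j q] j by auto
    moreover have "j \<le> i'" using run_le[of j i' q t] i' j t by simp
    ultimately have "j < i'" by simp
    moreover have "\<not> i \<le> i'"
      using hd_run_mono[of i i'] * i' i by (cases "i' = i") auto
    then have "i' < i" by simp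
    ultimately show False
      using run_rank_mono[of j i' x] run_rank_less[of i' i x] i x by simp
  qed
qed

lemma no_run_below:
  assumes j: "j < r" "hd_run j \<le> q" "q \<le> tl_run j" "bwt q \<noteq> x"
    and "run_rank T x j = run_rank T x r" "q < t" "t < n"
  shows "bwt t \<noteq> x"
proof
  assume t: "bwt t = x"
  obtain i' where i': "i' < r" "hd_run i' \<le> t" "t \<le> tl_run i'" using run_exists assms by blast
  then have x: "bwt (hd_run i') = x" using BWT_run t by metis
  have "j \<le> i'" using run_le[of j i' q t] i' assms by simp
  then show False
    using run_rank_less[of i' r x] run_rank_mono[of j i' x] x assms i' by simp
qed

section \<open>Matching statistics\<close>

text \<open>The matching statistic of \<open>S\<close>, that is the length of its longest prefix
  occurring in the text, together with a witnessing row.\<close>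

definition best where
  "best S q l \<longleftrightarrow> q < n \<and> lcp S (suf q) = l \<and> (\<forall>t<n. lcp S (suf t) \<le> l)"

lemma best_lcp:
  assumes "best S q l" "t < n"
  shows "lcp S (suf t) = min l (LCE T (sa q) (sa t))"
  using lcp_best[of S "suf t" "suf q"] assms by (simp add: best_def LCE_eq_lcp)

text \<open>By \<open>best_lcp\<close> the match of a row is its LCE with row \<open>q\<close>,
  capped at \<open>l\<close>, and the LCE falls with the lexicographic distance.\<close>

lemma best_mono_above: "best S q l \<Longrightarrow> t \<le> u \<Longrightarrow> u \<le> q \<Longrightarrow> lcp S (suf t) \<le> lcp S (suf u)"
  using lcp_mono_lexord(2)[of "suf t" "suf u" "suf q"] suf_mono[of t u] suf_mono[of u q]
    best_lcp[of S q l t] best_lcp[of S q l u] lcp_commute[of "suf q"]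
  by (auto simp: best_def LCE_eq_lcp)

lemma best_mono_below:
  "best S q l \<Longrightarrow> q \<le> u \<Longrightarrow> u \<le> t \<Longrightarrow> t < n \<Longrightarrow> lcp S (suf t) \<le> lcp S (suf u)"
  using lcp_mono_lexord(1)[of "suf q" "suf u" "suf t"] suf_mono[of q u] suf_mono[of u t]
    best_lcp[of S q l t] best_lcp[of S q l u]
  by (auto simp: best_def LCE_eq_lcp)

lemma best_le_n: "best S q l \<Longrightarrow> l \<le> n"
  using lcp_le_length(2)[of S "suf q"] by (auto simp: best_def)

text \<open>A row with a match for the pattern \<open>x # S\<close> arises by \<open>LF\<close> from a row with a match for \<open>S\<close>,
  except that the terminator only matches itself.\<close>

lemma best_extend:
  assumes q: "q < n" "bwt q = x"
    and best: "\<And>t. t < n \<Longrightarrow> bwt t = x \<Longrightarrow> lcp S (suf t) \<le> lcp S (suf q)"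
  shows "best (x # S) (LF T q) (if sa q = 0 then 1 else Suc (lcp S (suf q)))"
  unfolding best_def
proof (intro conjI allI impI)
  show "LF T q < n" using LF_less q by simp
  have pos_eq: "lcp (x # S) (suf (LF T t)) = Suc (lcp S (suf t))"
    if "t < n" "0 < sa t" "bwt t = x" for t
    using suf_LF that by simp
  have zero: "lcp (x # S) (suf (LF T t)) = 1" if "t < n" "sa t = 0" "bwt t = x" for t
  proof -
    have "suf (LF T t) = [T ! (n - 1)]"
      using that sa_LF n_pos Cons_nth_drop_Suc[of "n - 1" T] by (simp add: prev_pos_eq)
    then show ?thesis using BWT_eq_last_iff[of t] that by simp
  qed
  show "lcp (x # S) (suf (LF T q)) = (if sa q = 0 then 1 else Suc (lcp S (suf q)))"
    using pos_eq zero q by auto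
  fix u assume u: "u < n"
  have "\<exists>t<n. LF T t = u"
  proof -
    obtain t where "t < n" "prev_pos T (sa t) = sa u" using ex_next u by blast
    then have "t < n" "sa (LF T t) = sa u" using sa_LF by auto
    then show ?thesis using sa_eq_iff LF_less u by blast
  qed
  then obtain t where t: "t < n" "LF T t = u" by blast
  show "lcp (x # S) (suf u) \<le> (if sa q = 0 then 1 else Suc (lcp S (suf q)))"
  proof (cases "bwt t = x")
    case False
    have "sa u < n" using u sa_less by simp
    moreover have "T ! sa u = bwt t" using t sa_LF by (auto simp: BWT_def)
    ultimately have "suf u = bwt t # drop (Suc (sa u)) T" by (metis Cons_nth_drop_Suc)
    then show ?thesis using False by simp
  next
    case True
    show ?thesis
    proof (cases "sa q = 0 \<or> sa t = 0")
      case False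
      then show ?thesis using pos_eq[of t] True t best[of t] by simp
    next
      case zeros: True
      \<comment> \<open>Only one row carries the terminator, so once one of \<open>q\<close> and
        \<open>t\<close> is at the text start they coincide.\<close>
      have "t = q"
      proof (rule ccontr)
        assume "t \<noteq> q"
        then have "0 < sa t" "0 < sa q"
          using same_BWT_pos[of t q] same_BWT_pos[of q t] True q t by simp_all
        then show False using zeros by simp
      qed
      then show ?thesis using pos_eq[of q] zero[of q] q t by auto
    qed
  qed
qed

text \<open>Every text symbol appears in the BWT, so no suffix begins with \<open>x\<close>. All
  rows then match to length 0 and the old row may be kept.\<close>

lemma best_absent:
  assumes q: "q < n" and absent: "\<And>t. t < n \<Longrightarrow> bwt t \<noteq> x"
  shows "best (x # S) q 0"
proof -
  have "lcp (x # S) (suf u) = 0" if u: "u < n" for u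
  proof -
    obtain t where "t < n" "prev_pos T (sa t) = sa u" using ex_next u by blast
    then have "T ! sa u \<noteq> x" using absent[of t] by (simp add: BWT_def)
    then show ?thesis
      using Cons_nth_drop_Suc[OF sa_less[OF u]] by (metis lcp.simps(1))
  qed
  then show ?thesis using q by (simp add: best_def)
qed

section \<open>Prefixes with at least k occurrences and k-MEMs\<close>

definition ms where
  "ms k S = Max {l. l \<le> length S \<and> (l = 0 \<or> k \<le> occurrences (take l S) T)}"

text \<open>The bijection \<open>sa\<close> turns counting text positions into counting rows. A
  positive \<open>l\<close> excludes the occurrence of the empty string at position
  \<open>n\<close>.\<close>

lemma occurrences_eq:
  assumes "0 < l" "l \<le> length S"
  shows "occurrences (take l S) T = card {t. t < n \<and> l \<le> lcp S (suf t)}"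
proof -
  have "bij_betw sa {t \<in> {..<n}. l \<le> lcp S (suf t)} {p \<in> {..<n}. l \<le> lcp S (drop p T)}"
    using bij_betw_sa by (auto simp: bij_betw_def inj_on_def image_iff Bex_def)+
  then have "card {t. t < n \<and> l \<le> lcp S (suf t)} = card {p. p < n \<and> l \<le> lcp S (drop p T)}"
    by (auto dest: bij_betw_same_card)
  moreover have "{p. p < n \<and> l \<le> lcp S (drop p T)} =
      {p. p + length (take l S) \<le> n \<and> take (length (take l S)) (drop p T) = take l S}"
    using assms by (auto simp: le_lcp_iff)
  ultimately show ?thesis by (simp add: occurrences_def)
qed

text \<open>Shorter prefixes occur at least as often, so the set maximised in \<open>ms\<close> is
  downward closed.\<close>

lemma le_ms_iff:
  assumes "0 < l" "l \<le> length S"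
  shows "l \<le> ms k S \<longleftrightarrow> k \<le> occurrences (take l S) T"
proof -
  let ?A = "{l. l \<le> length S \<and> (l = 0 \<or> k \<le> occurrences (take l S) T)}"
  have fin: "finite ?A" by simp
  show ?thesis
  proof
    assume "k \<le> occurrences (take l S) T"
    then show "l \<le> ms k S" unfolding ms_def using assms fin by (intro Max_ge) auto
  next
    assume le: "l \<le> ms k S"
    have "ms k S \<in> ?A" unfolding ms_def using fin by (intro Max_in) auto
    then have m: "ms k S \<le> length S" "k \<le> occurrences (take (ms k S) S) T" using le assms by auto
    have "card {t. t < n \<and> ms k S \<le> lcp S (suf t)} \<le> card {t. t < n \<and> l \<le> lcp S (suf t)}"
      using le by (intro card_mono) auto
    then show "k \<le> occurrences (take l S) T"
      using m occurrences_eq[of "ms k S" S] occurrences_eq[of l S] assms le by simp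
  qed
qed

lemma ms_le_length: "ms k S \<le> length S"
  unfolding ms_def by (intro Max.boundedI) auto

lemma ms_eqI:
  assumes "v \<le> length S"
    and "\<And>l. 0 < l \<Longrightarrow> l \<le> length S \<Longrightarrow> k \<le> occurrences (take l S) T \<longleftrightarrow> l \<le> v"
  shows "ms k S = v"
  using le_ms_iff[of "ms k S" S k] le_ms_iff[of v S k] assms ms_le_length[of k S]
  by (metis antisym gr0I le0 order.refl)

lemma ms_Nil [simp]: "ms k [] = 0"
  using ms_le_length[of k "[]"] by simp

text \<open>A nonempty string occurs at most once per row. This justifies clamping \<open>k\<close>
  to a word and the early exit of \<open>compute_ms\<close>.\<close>

lemma ms_large: "n < k \<Longrightarrow> ms k S = 0"
proof (rule ms_eqI)
  fix l assume l: "n < k" "0 < l" "l \<le> length S"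
  have "card {t. t < n \<and> l \<le> lcp S (suf t)} \<le> card {..<n}" by (intro card_mono) auto
  then show "k \<le> occurrences (take l S) T \<longleftrightarrow> l \<le> 0" using l occurrences_eq[of l S] by simp
qed simp

text \<open>Together with the occurrence bound, right maximality fixes the length as
  \<open>ms\<close> at \<open>i\<close>. The left extension is one symbol longer, so it has fewer
  than \<open>k\<close> occurrences iff \<open>ms\<close> at \<open>i - 1\<close> is below that
  length plus one, whence the non-strict comparison.\<close>

lemma is_kmem_iff:
  "is_kmem k P T i j \<longleftrightarrow>
     i < length P \<and> 0 < ms k (drop i P) \<and> j + 1 = i + ms k (drop i P) \<and>
     (i = 0 \<or> ms k (drop (i - 1) P) \<le> ms k (drop i P))"
proof (cases "i \<le> j \<and> j < length P")
  case True
  have iff: "k \<le> occurrences (substring P a b) T \<longleftrightarrow> b + 1 - a \<le> ms k (drop a P)"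
    if "a \<le> b" "b < length P" for a b
  proof -
    have "0 < b + 1 - a" "b + 1 - a \<le> length (drop a P)" using that by auto
    then show ?thesis unfolding substring_def by (rule le_ms_iff[symmetric])
  qed
  have 1: "k \<le> occurrences (substring P i j) T \<longleftrightarrow> j + 1 - i \<le> ms k (drop i P)"
    using True iff by blast
  have 2: "occurrences (substring P (i - 1) j) T < k \<longleftrightarrow> \<not> j + 2 - i \<le> ms k (drop (i - 1) P)"
    if "i \<noteq> 0"
  proof -
    have "i - 1 \<le> j" "j < length P" "j + 1 - (i - 1) = j + 2 - i" using True that by linarith+
    then show ?thesis using iff[of "i - 1" j] by (metis not_le)
  qed
  have 3: "occurrences (substring P i (j + 1)) T < k \<longleftrightarrow> \<not> j + 2 - i \<le> ms k (drop i P)"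
    if "j \<noteq> length P - 1"
  proof -
    have "i \<le> j + 1" "j + 1 < length P" using True that by linarith+
    moreover have "j + 1 + 1 - i = j + 2 - i" by simp
    ultimately show ?thesis using iff[of i "j + 1"] by (metis not_le)
  qed
  let ?m = "ms k (drop i P)" and ?m' = "ms k (drop (i - 1) P)"
  have "?m \<le> length P - i" using ms_le_length[of k "drop i P"] by simp
  then have eq: "j + 1 - i \<le> ?m \<and> (j = length P - 1 \<or> \<not> j + 2 - i \<le> ?m) \<longleftrightarrow> j + 1 = i + ?m"
    using True by arith
  have prev: "\<not> j + 2 - i \<le> ?m' \<longleftrightarrow> ?m' \<le> ?m" if "j + 1 = i + ?m"
    using True that by arith
  have "is_kmem k P T i j \<longleftrightarrow> j + 1 - i \<le> ?m \<and> (i = 0 \<or> \<not> j + 2 - i \<le> ?m') \<and>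
      (j = length P - 1 \<or> \<not> j + 2 - i \<le> ?m)"
    unfolding is_kmem_def using True 1 2 3 by meson
  also have "\<dots> \<longleftrightarrow> j + 1 = i + ?m \<and> (i = 0 \<or> ?m' \<le> ?m)"
    using eq prev by meson
  also have "\<dots> \<longleftrightarrow> i < length P \<and> 0 < ?m \<and> j + 1 = i + ?m \<and> (i = 0 \<or> ?m' \<le> ?m)"
    using True by arith
  finally show ?thesis .
next
  case False
  have "\<not> is_kmem k P T i j" using False unfolding is_kmem_def by blast
  \<comment> \<open>This bound makes the right-hand side imply \<open>i \<le> j\<close> and
    \<open>j < length P\<close>, so both sides are false here.\<close>
  moreover have "ms k (drop i P) \<le> length P - i" using ms_le_length[of k "drop i P"] by simp
  ultimately show ?thesis using False by arith
qed

section \<open>Windows of best-matching rows\<close>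

definition window where
  "window S a b v \<longleftrightarrow> a \<le> b \<and> b < n \<and> (\<forall>t\<in>{a..b}. v \<le> lcp S (suf t)) \<and>
     (\<exists>t\<in>{a..b}. lcp S (suf t) = v) \<and> (\<forall>t<n. t \<notin> {a..b} \<longrightarrow> lcp S (suf t) \<le> v)"

text \<open>Here \<open>v\<close> is the \<open>k\<close>-th largest match length. For
  \<open>l \<le> v\<close> the whole window matches to length \<open>l\<close>; for larger
  \<open>l\<close> no outside row does, and the row attaining \<open>v\<close> drops out, leaving
  fewer than \<open>k\<close>.\<close>

lemma window_ms:
  assumes w: "window S a b v" and k: "k = Suc (b - a)"
  shows "ms k S = v"
proof (rule ms_eqI)
  obtain t0 where t0: "t0 \<in> {a..b}" "lcp S (suf t0) = v" using w by (auto simp: window_def)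
  then show "v \<le> length S" using lcp_le_length by metis
  fix l assume l: "0 < l" "l \<le> length S"
  let ?A = "{t. t < n \<and> l \<le> lcp S (suf t)}"
  have card: "card {a..b} = k" using w k by (simp add: window_def Suc_diff_le)
  have "k \<le> card ?A" if "l \<le> v"
  proof -
    have "{a..b} \<subseteq> ?A" using w that unfolding window_def
      by (auto intro: le_trans)
    then show ?thesis using card card_mono[of ?A "{a..b}"] by simp
  qed
  moreover have "card ?A < k" if "\<not> l \<le> v"
  proof -
    have "?A \<subseteq> {a..b} - {t0}" using w that t0 by (fastforce simp: window_def)
    then have "card ?A < card {a..b}" using t0 by (intro psubset_card_mono) auto
    then show ?thesis using card by simp
  qed
  ultimately show "k \<le> occurrences (take l S) T \<longleftrightarrow> l \<le> v"
    using occurrences_eq[OF l] by fastforce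
qed

lemma window_init: "best S q l \<Longrightarrow> window S q q l"
  by (auto simp: window_def best_def)

text \<open>Matches decrease away from \<open>q\<close>, so each row outside the window is dominated
  by the neighbour on its side, and the better neighbour dominates both sides.\<close>

lemma window_up:
  assumes "best S q l" "window S a b v" "a \<le> q" "q \<le> b" "0 < a"
    and "Suc b < n \<Longrightarrow> lcp S (suf (Suc b)) \<le> lcp S (suf (a - 1))"
  shows "window S (a - 1) b (lcp S (suf (a - 1)))"
  unfolding window_def
proof (intro conjI ballI allI impI)
  have v: "lcp S (suf (a - 1)) \<le> v" using assms by (auto simp: window_def)
  show "a - 1 \<le> b" "b < n" using assms by (auto simp: window_def)
  show "\<exists>t\<in>{a - 1..b}. lcp S (suf t) = lcp S (suf (a - 1))" using assms by auto
  fix t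
  show "lcp S (suf (a - 1)) \<le> lcp S (suf t)" if "t \<in> {a - 1..b}"
  proof (cases "t = a - 1")
    case False
    then have "v \<le> lcp S (suf t)" using that assms by (auto simp: window_def)
    then show ?thesis using v by simp
  qed simp
  show "lcp S (suf t) \<le> lcp S (suf (a - 1))" if t: "t < n" "t \<notin> {a - 1..b}"
  proof (cases "t < a")
    case True
    then show ?thesis using best_mono_above[of S q l t "a - 1"] assms by auto
  next
    case False
    then have le: "Suc b \<le> t" using t by auto
    have "lcp S (suf t) \<le> lcp S (suf (Suc b))"
      by (rule best_mono_below[OF assms(1) _ le t(1)]) (use assms(4) in simp)
    also have "\<dots> \<le> lcp S (suf (a - 1))" using assms(6) le t(1) by simp
    finally show ?thesis .
  qed
qed

lemma window_down:
  assumes "best S q l" "window S a b v" "a \<le> q" "q \<le> b" "Suc b < n"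
    and "0 < a \<Longrightarrow> lcp S (suf (a - 1)) \<le> lcp S (suf (Suc b))"
  shows "window S a (Suc b) (lcp S (suf (Suc b)))"
  unfolding window_def
proof (intro conjI ballI allI impI)
  have v: "lcp S (suf (Suc b)) \<le> v" using assms by (auto simp: window_def)
  show "a \<le> Suc b" "Suc b < n" using assms by auto
  show "\<exists>t\<in>{a..Suc b}. lcp S (suf t) = lcp S (suf (Suc b))" using assms by auto
  fix t
  show "lcp S (suf (Suc b)) \<le> lcp S (suf t)" if "t \<in> {a..Suc b}"
  proof (cases "t = Suc b")
    case False
    then have "v \<le> lcp S (suf t)" using that assms by (auto simp: window_def)
    then show ?thesis using v by simp
  qed simp
  show "lcp S (suf t) \<le> lcp S (suf (Suc b))" if t: "t < n" "t \<notin> {a..Suc b}"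
  proof (cases "b < t")
    case True
    then show ?thesis using best_mono_below[of S q l "Suc b" t] assms t by auto
  next
    case False
    then have le: "t \<le> a - 1" "0 < a" using t by auto
    have "lcp S (suf t) \<le> lcp S (suf (a - 1))"
      by (rule best_mono_above[OF assms(1) le(1)]) (use assms(3) in simp)
    also have "\<dots> \<le> lcp S (suf (Suc b))" using assms(6) le(2) by simp
    finally show ?thesis .
  qed
qed

end

section \<open>Weakest preconditions with running time\<close>

text \<open>The existential form covers termination and the absence of faults, and determinism makes
  it a statement about the one execution.\<close>

definition wp ::
  "nat \<Rightarrow> moni \<Rightarrow> nat list list \<Rightarrow> com \<Rightarrow> (nat \<Rightarrow> state \<Rightarrow> bool) \<Rightarrow> state \<Rightarrow> bool" where
  "wp w M D c Q s \<longleftrightarrow> (\<exists>t s'. exec w M D c s t s' \<and> Q t s')"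

lemma wp_mono: "wp w M D c Q s \<Longrightarrow> (\<And>t s'. Q t s' \<Longrightarrow> Q' t s') \<Longrightarrow> wp w M D c Q' s"
  by (auto simp: wp_def)

lemma wp_exec: "exec w M D c s t s' \<Longrightarrow> wp w M D c Q s \<longleftrightarrow> Q t s'"
  unfolding wp_def using exec_deterministic by blast

lemma wp_Skip: "wp w M D Skip Q s \<longleftrightarrow> Q 1 s"
  by (rule wp_exec[OF exec.Skip])

lemma wp_Assign: "wp w M D (Assign x e) Q s \<longleftrightarrow> Q (1 + cost e) (set_reg w x (eval w e s) s)"
  by (rule wp_exec[OF exec.Assign])

lemma wp_Data:
  "wp w M D (Data x a e) Q s \<longleftrightarrow> a < length D \<and> eval w e s < length (D ! a) \<and>
     Q (1 + cost e) (set_reg w x (D ! a ! eval w e s) s)"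
  unfolding wp_def by (auto simp del: One_nat_def plus_1_eq_Suc intro: exec.Data elim: exec.cases)

lemma wp_Table:
  "wp w M D (Table x col e) Q s \<longleftrightarrow> eval w e s < length (table M col) \<and>
     Q (1 + cost e) (set_reg w x (table M col ! eval w e s) s)"
  unfolding wp_def by (auto simp del: One_nat_def plus_1_eq_Suc intro: exec.Table elim: exec.cases)

lemma wp_Access:
  "wp w M D (Access x e) Q s \<longleftrightarrow> (let a = wt_access M (eval w e s) in
     Q (1 + cost e + snd a) (set_reg w x (fst a) s))"
  unfolding Let_def by (rule wp_exec[OF exec.Access]) simp

lemma wp_Rank:
  "wp w M D (Rank x e1 e2) Q s \<longleftrightarrow> (let a = wt_rank M (eval w e1 s) (eval w e2 s) in
     Q (1 + cost e1 + cost e2 + snd a) (set_reg w x (fst a) s))"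
  unfolding Let_def by (rule wp_exec[OF exec.Rank]) simp

lemma wp_Select:
  "wp w M D (Select x e1 e2) Q s \<longleftrightarrow> (let a = wt_select M (eval w e1 s) (eval w e2 s) in
     Q (1 + cost e1 + cost e2 + snd a) (set_reg w x (fst a) s))"
  unfolding Let_def by (rule wp_exec[OF exec.Select]) simp

lemma wp_Lce:
  "wp w M D (Lce x e1 e2) Q s \<longleftrightarrow> (let a = lce_query M (eval w e1 s) (eval w e2 s) in
     Q (1 + cost e1 + cost e2 + snd a) (set_reg w x (fst a) s))"
  unfolding Let_def by (rule wp_exec[OF exec.Lce]) simp

lemma wp_Seq: "wp w M D (c1 ;; c2) Q s \<longleftrightarrow> wp w M D c1 (\<lambda>t. wp w M D c2 (\<lambda>u. Q (t + u))) s"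
  unfolding wp_def by (blast intro: exec.Seq elim: exec.cases[of w M D "c1 ;; c2"])

lemma wp_Cond:
  "wp w M D (Cond e c1 c2) Q s \<longleftrightarrow>
     (if eval w e s \<noteq> 0 then wp w M D c1 (\<lambda>t. Q (1 + cost e + t)) s
      else wp w M D c2 (\<lambda>t. Q (1 + cost e + t)) s)"
proof -
  have "exec w M D (Cond e c1 c2) s t s' \<longleftrightarrow>
      (\<exists>u. t = 1 + cost e + u \<and> exec w M D (if eval w e s \<noteq> 0 then c1 else c2) s u s')" for t s'
    by (subst exec.simps) auto
  then show ?thesis by (auto simp: wp_def)
qed

text \<open>Unfolds one iteration. It is kept out of \<open>wp_simps\<close>, where rewriting with
  it could go on forever.\<close>

lemma wp_While:
  "wp w M D (While e c) Q s \<longleftrightarrow>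
     (if eval w e s \<noteq> 0
      then wp w M D c (\<lambda>t. wp w M D (While e c) (\<lambda>u. Q (1 + cost e + t + u))) s
      else Q (1 + cost e) s)"
proof -
  have "exec w M D (While e c) s t s' \<longleftrightarrow>
      (if eval w e s \<noteq> 0
       then \<exists>t1 t2 s1. t = 1 + cost e + t1 + t2 \<and> exec w M D c s t1 s1 \<and>
         exec w M D (While e c) s1 t2 s'
       else t = 1 + cost e \<and> s' = s)" for t s'
    by (subst exec.simps) auto
  then show ?thesis unfolding wp_def by (simp split: if_split) blast
qed

lemmas wp_simps = wp_Skip wp_Assign wp_Data wp_Table wp_Access wp_Rank wp_Select wp_Lce wp_Seq
  wp_Cond Let_def

lemma regs_set_reg [simp]: "regs (set_reg w x v s) = (regs s)(x := v mod 2 ^ w)"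
  by (simp add: set_reg_def)

lemma regs_feed [simp]: "regs (feed x s) = (regs s)(1 := x)"
  by (simp add: feed_def)

lemma apply_Plus: "a + b < 2 ^ w \<Longrightarrow> apply_op w Plus a b = a + b"
  by simp

lemma apply_Minus: "b \<le> a \<Longrightarrow> a < 2 ^ w \<Longrightarrow> apply_op w Minus a b = a - b"
  by (simp add: mod_if)

text \<open>Addition and subtraction are left to \<open>apply_Plus\<close> and
  \<open>apply_Minus\<close>, whose premises exclude overflow and underflow.\<close>

lemmas [simp del] = apply_op.simps(1,2)

text \<open>A time budget in place of exact times, so that programs can be verified piecewise and
  their bounds added.\<close>

definition runs ::
  "nat \<Rightarrow> moni \<Rightarrow> nat list list \<Rightarrow> com \<Rightarrow> nat \<Rightarrow> (state \<Rightarrow> bool) \<Rightarrow> state \<Rightarrow> bool" where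
  "runs w M D c B Q s \<longleftrightarrow> wp w M D c (\<lambda>t s'. t \<le> B \<and> Q s') s"

lemma runs_Seq:
  assumes "runs w M D c1 B1 Q1 s" "\<And>s'. Q1 s' \<Longrightarrow> runs w M D c2 B2 Q s'" "B1 + B2 \<le> B"
  shows "runs w M D (c1 ;; c2) B Q s"
  unfolding runs_def wp_Seq
  by (rule wp_mono[OF assms(1)[unfolded runs_def]], rule wp_mono[OF assms(2)[unfolded runs_def]])
    (use assms(3) in auto)

lemma runs_mono:
  "runs w M D c B Q s \<Longrightarrow> B \<le> B' \<Longrightarrow> (\<And>s'. Q s' \<Longrightarrow> Q' s') \<Longrightarrow> runs w M D c B' Q' s"
  unfolding runs_def by (erule wp_mono) auto

lemma runs_Cond:
  assumes "eval w e s \<noteq> 0 \<Longrightarrow> runs w M D c1 B1 Q s" "eval w e s = 0 \<Longrightarrow> runs w M D c2 B1 Q s"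
    "1 + cost e + B1 \<le> B"
  shows "runs w M D (Cond e c1 c2) B Q s"
proof -
  have "wp w M D c (\<lambda>t s'. 1 + cost e + t \<le> B \<and> Q s') s" if "runs w M D c B1 Q s" for c
    using that unfolding runs_def by (rule wp_mono) (use assms(3) in auto)
  then show ?thesis using assms(1,2) unfolding runs_def wp_Cond by simp
qed

lemma runs_While_done:
  "eval w e s = 0 \<Longrightarrow> Q s \<Longrightarrow> 1 + cost e \<le> B \<Longrightarrow> runs w M D (While e c) B Q s"
  unfolding runs_def by (subst wp_While) simp

lemma runs_While_step:
  assumes "eval w e s \<noteq> 0" "runs w M D c B1 Q1 s"
    "\<And>s'. Q1 s' \<Longrightarrow> runs w M D (While e c) B2 Q s'" "1 + cost e + B1 + B2 \<le> B"
  shows "runs w M D (While e c) B Q s"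
proof -
  have "wp w M D c (\<lambda>t. wp w M D (While e c) (\<lambda>u s'. 1 + cost e + t + u \<le> B \<and> Q s')) s"
    by (rule wp_mono[OF assms(2)[unfolded runs_def]], rule wp_mono[OF assms(3)[unfolded runs_def]])
      (use assms(4) in auto)
  then show ?thesis unfolding runs_def by (subst wp_While) (use assms(1) in simp)
qed

section \<open>The programs and their verification\<close>

text \<open>Registers 3 and 4 hold \<open>n\<close> and \<open>r\<close>; registers 5, 6 and 7 the best row, its text position and
  its match length; registers 8 and 9 the current and the previous value of \<open>ms\<close>. Registers 10 to 19
  are local to each phase. In \<open>compute_ms\<close>, the window consists of the rows from register 10 to
  register 12, whose text positions are in registers 11 and 13, and its worst match is in register
  19; register 14 counts down. In \<open>find_row\<close>, register 10 is the run of the row, register 12 tells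
  whether the symbol occurs in the text at all, and registers 13 and 14 are ranks. Registers from
  20 on belong to \<open>bsearch\<close> and \<open>walk\<close>.\<close>

abbreviation inc where "inc x \<equiv> Op Plus (Reg x) (Const 1)"
abbreviation dec where "dec x \<equiv> Op Minus (Reg x) (Const 1)"

definition bsearch_loop :: "nat \<Rightarrow> nat \<Rightarrow> com" where
  "bsearch_loop x a = While (Op Less (Const 1) (Op Minus (Reg 21) (Reg 20)))
     (Assign 22 (Op Div (Op Plus (Reg 20) (Reg 21)) (Const 2)) ;;
      Data 23 a (Reg 22) ;;
      Cond (Op Less (Reg x) (Reg 23)) (Assign 21 (Reg 22)) (Assign 20 (Reg 22)))"

definition bsearch :: "nat \<Rightarrow> nat \<Rightarrow> com" where
  "bsearch x a = Assign 20 (Const 0) ;; Assign 21 (Reg 4) ;; bsearch_loop x a"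

text \<open>Evaluates a piecewise translation: array \<open>a\<close> lists the breakpoints in
  increasing order and array \<open>b\<close> their images.\<close>

definition walk :: "nat \<Rightarrow> nat \<Rightarrow> nat \<Rightarrow> nat \<Rightarrow> com" where
  "walk x y a b = bsearch x a ;; Data 21 a (Reg 20) ;; Data 22 b (Reg 20) ;;
     Assign y (Op Plus (Reg 22) (Op Minus (Reg x) (Reg 21)))"

text \<open>Match lengths of candidate rows are stored incremented, so that 0 means that there is none.\<close>

definition match_len :: "nat \<Rightarrow> nat \<Rightarrow> com" where
  "match_len x y = Lce x (Reg 6) (Reg y) ;;
     Cond (Op Less (Reg 7) (Reg x)) (Assign x (inc 7)) (Assign x (inc x))"

definition look_up :: com where
  "look_up = Cond (Reg 10) (walk 11 17 3 4 ;; match_len 15 17) (Assign 15 (Const 0))"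

definition look_down :: com where
  "look_down = Cond (Op Less (inc 12) (Reg 3)) (walk 13 18 5 6 ;; match_len 16 18)
     (Assign 16 (Const 0))"

definition widen :: com where
  "widen = look_up ;; look_down ;;
     (Cond (Op Less (Reg 15) (Reg 16))
       (Assign 12 (inc 12) ;; Assign 13 (Reg 18) ;; Assign 19 (dec 16))
       (Assign 10 (dec 10) ;; Assign 11 (Reg 17) ;; Assign 19 (dec 15)) ;;
     Assign 14 (dec 14))"

text \<open>A window of \<open>k\<close> rows exists only for \<open>k \<le> n\<close>; otherwise
  the answer is 0. The window starts with one row, hence the \<open>k - 1\<close> rounds.\<close>

definition compute_ms :: com where
  "compute_ms = Cond (Op Less (Reg 3) (Reg 0)) (Assign 19 (Const 0))
     ((Assign 10 (Reg 5) ;; Assign 11 (Reg 6) ;; Assign 12 (Reg 5) ;; Assign 13 (Reg 6) ;;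
       Assign 19 (Reg 7) ;; Assign 14 (dec 0)) ;;
      While (Reg 14) widen)"

text \<open>The rank counts the earlier runs of the symbol, and \<open>Select\<close> counts from 0.
  So the index one below the rank is the last such run, whose tail is the nearest candidate
  above.\<close>

definition cand_up :: com where
  "cand_up = Cond (Reg 13)
     ((Select 17 (Reg 1) (dec 13) ;; Table 11 SA_Tail (Reg 17)) ;; match_len 15 11)
     (Assign 15 (Const 0))"

definition cand_down :: com where
  "cand_down = Cond (Op Less (Reg 13) (Reg 14))
     ((Select 18 (Reg 1) (Reg 13) ;; Table 19 SA_Head (Reg 18)) ;; match_len 16 19)
     (Assign 16 (Const 0))"

definition choose_row :: com where
  "choose_row = Cond (Op Less (Reg 15) (Reg 16))
     (Assign 10 (Reg 18) ;; Table 5 Head (Reg 18) ;; Assign 6 (Reg 19) ;;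
      Assign 7 (dec 16) ;; Assign 12 (Const 1))
     (Cond (Reg 15)
       (Assign 10 (Reg 17) ;; Table 5 Tail (Reg 17) ;; Assign 6 (Reg 11) ;;
        Assign 7 (dec 15) ;; Assign 12 (Const 1))
       (Assign 7 (Const 0) ;; Assign 12 (Const 0)))"

text \<open>If the current row already carries the symbol, it is itself the best candidate;
  otherwise the nearest ones on both sides compete.\<close>

definition find_row :: com where
  "find_row = bsearch 5 1 ;; (Assign 10 (Reg 20) ;; Access 11 (Reg 10)) ;;
     Cond (Op Eq (Reg 11) (Reg 1)) (Assign 12 (Const 1))
      ((Rank 13 (Reg 1) (Reg 10) ;; Rank 14 (Reg 1) (Reg 4)) ;; cand_up ;; cand_down ;; choose_row)"

text \<open>Register 6 is 0 at the text start, where \<open>LF\<close> wraps to position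
  \<open>n - 1\<close> and only the terminator is matched.\<close>

definition extend :: com where
  "extend = Cond (Reg 12)
     (Data 21 1 (Reg 10) ;; Data 22 2 (Reg 10) ;;
      Assign 5 (Op Plus (Reg 22) (Op Minus (Reg 5) (Reg 21))) ;;
      Cond (Reg 6) (Assign 6 (dec 6) ;; Assign 7 (inc 7)) (Assign 6 (dec 3) ;; Assign 7 (Const 1)))
     Skip"

definition init_prog :: com where
  "init_prog = Data 3 0 (Const 0) ;; Data 4 0 (Const 1) ;; Assign 6 (dec 3)"

text \<open>The report lags one character behind, because left maximality compares the old value of
  \<open>ms\<close> with the new one.\<close>

definition step_prog :: com where
  "step_prog = find_row ;; extend ;; Assign 9 (Reg 8) ;; compute_ms ;;
     (Assign 8 (Reg 19) ;; Cond (Op Less (Reg 9) (Reg 8)) (Assign 2 (Const 0)) (Assign 2 (Reg 9)))"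

definition fin_prog :: com where
  "fin_prog = Assign 2 (Reg 8)"

section \<open>Stored arrays, word bounds and queries\<close>

locale moni_text = indexed_text +
  fixes c w :: nat and M :: moni
  assumes lg_less_w: "lg n < w"
    and symbols: "\<forall>x \<in> set T. x < 2 ^ w"
    and is_moni: "is_moni c T M"
begin

text \<open>Arrays 3 and 4 hold breakpoints and images of the step to the row above, arrays 5 and 6
  those of the step to the row below. Row 0 is always a head and the last row always a tail; their
  missing neighbours get placeholder entries.\<close>

definition D :: "nat list list" where
  "D = [[n, r], map hd_run [0..<r], map (\<lambda>j. LF T (hd_run j)) [0..<r],
        sorted_list_of_set (sa ` heads),
        map (\<lambda>p. sa (row p - 1)) (sorted_list_of_set (sa ` heads)),
        sorted_list_of_set (sa ` tails),
        map (\<lambda>p. if Suc (row p) < n then sa (Suc (row p)) else 0) (sorted_list_of_set (sa ` tails))]"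

lemma n_less_lg: "n < 2 ^ lg n"
  using n_pos floorlog_bounds[of n 2] by (simp add: lg_def)

lemma lg_pos: "0 < lg n"
  using n_less_lg n_pos by (cases "lg n") auto

text \<open>The spare bit from \<open>lg n < w\<close> leaves room for sums of two numbers up to
  \<open>n\<close> and for incremented match lengths.\<close>

lemma word_bound: "2 * n + 2 \<le> 2 ^ w"
proof -
  have "(2::nat) ^ Suc (lg n) \<le> 2 ^ w" using lg_less_w by (intro power_increasing) auto
  then show ?thesis using n_less_lg by simp
qed

lemma le_n_word: "x \<le> n \<Longrightarrow> x < 2 ^ w"
  using word_bound by linarith

lemma mod_word [simp]: "x \<le> n \<Longrightarrow> x mod 2 ^ w = x"
  using le_n_word by simp

lemma w_pos [simp]: "0 < w"
  using lg_less_w by simp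

lemma eval_const [simp]: "eval w (Const 0) s = 0" "eval w (Const 1) s = 1"
    "eval w (Const (Suc 0)) s = 1" "eval w (Const 2) s = 2"
proof -
  have "4 \<le> (2::nat) ^ w" using word_bound n_pos by linarith
  then show "eval w (Const 2) s = 2" by simp
qed simp_all

lemma bwt_word: "q < n \<Longrightarrow> bwt q < 2 ^ w"
  using symbols prev_pos_less by (auto simp: BWT_def)

lemma run_rank_le: "run_rank T x j \<le> j"
proof -
  have "run_rank T x j \<le> card {..<j}" unfolding run_rank_def by (rule card_mono) auto
  then show ?thesis by simp
qed

lemma table_length [simp]: "length (table M col) = r"
  and table_nth [simp]: "j < r \<Longrightarrow> table M col ! j = column_entry T col j"
  using is_moni by (simp_all add: is_moni_def)

lemma access [simp]: "j < r \<Longrightarrow> fst (wt_access M j) = bwt (hd_run j)"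
  and access_time: "j < r \<Longrightarrow> snd (wt_access M j) \<le> c * lg n"
  and rank [simp]: "j \<le> r \<Longrightarrow> fst (wt_rank M x j) = run_rank T x j"
  and rank_time: "j \<le> r \<Longrightarrow> snd (wt_rank M x j) \<le> c * lg n"
  and lce [simp]: "a < n \<Longrightarrow> b < n \<Longrightarrow> fst (lce_query M a b) = LCE T a b"
  and lce_time: "a < n \<Longrightarrow> b < n \<Longrightarrow> snd (lce_query M a b) \<le> c * lg n"
  using is_moni unfolding is_moni_def by blast+

lemma select:
  assumes "i < run_rank T x r"
  shows "fst (wt_select M x i) < r" "bwt (hd_run (fst (wt_select M x i))) = x"
    "run_rank T x (fst (wt_select M x i)) = i" "snd (wt_select M x i) \<le> c * lg n"
  using assms is_moni unfolding is_moni_def by blast+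

section \<open>Binary search and piecewise translations\<close>

abbreviation runs' where "runs' \<equiv> runs w M D"

text \<open>Invariant: entry \<open>lo\<close> is at most the key and entry \<open>hi\<close>, if
  there is one, exceeds it. The gap is at most \<open>2 ^ f\<close> and halves in each round. The
  end \<open>hi = r\<close> acts as a sentinel that is never read.\<close>

lemma bsearch_loop:
  assumes a: "a < length D" "length (D ! a) = r" "\<forall>v\<in>set (D ! a). v \<le> n" and x: "x < 20"
  shows "lo < hi \<Longrightarrow> hi \<le> r \<Longrightarrow> hi - lo \<le> 2 ^ f \<Longrightarrow>
      D ! a ! lo \<le> regs s x \<Longrightarrow> (hi < r \<Longrightarrow> regs s x < D ! a ! hi) \<Longrightarrow>
      regs s 20 = lo \<Longrightarrow> regs s 21 = hi \<Longrightarrow>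
      runs' (bsearch_loop x a) (30 * f + 10)
        (\<lambda>s'. regs s' 20 < r \<and> D ! a ! regs s' 20 \<le> regs s x \<and>
          (Suc (regs s' 20) < r \<longrightarrow> regs s x < D ! a ! Suc (regs s' 20)) \<and>
          (\<forall>y<20. regs s' y = regs s y)) s"
proof (induction f arbitrary: lo hi s)
  case 0
  then have hi: "hi = Suc lo" by simp
  have "apply_op w Minus hi lo = 1"
    using apply_Minus[of lo hi w] hi le_n_word[of hi] 0 r_le_n by simp
  then show ?case
    unfolding bsearch_loop_def using 0 hi by (intro runs_While_done) auto
next
  case (Suc f)
  have hi_word: "hi < 2 ^ w" using le_n_word[of hi] Suc.prems r_le_n by simp
  have minus: "apply_op w Minus hi lo = hi - lo"
    using apply_Minus[of lo hi w] hi_word Suc.prems by simp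
  show ?case
  proof (cases "hi = Suc lo")
    case True
    then show ?thesis
      unfolding bsearch_loop_def using Suc.prems minus by (intro runs_While_done) auto
  next
    case False
    define mid where "mid = (lo + hi) div 2"
    have mid: "lo < mid" "mid < hi" "mid - lo \<le> 2 ^ f" "hi - mid \<le> 2 ^ f"
      using Suc.prems(1,3) False by (auto simp: mid_def)
    have plus: "apply_op w Plus lo hi = lo + hi"
      using word_bound Suc.prems r_le_n by (intro apply_Plus) linarith
    have mid_le: "mid \<le> n" "mid < r" "D ! a ! mid \<le> n"
      using mid Suc.prems r_le_n a by auto
    let ?Q = "\<lambda>s'. (\<forall>y<20. regs s' y = regs s y) \<and>
        (if regs s x < D ! a ! mid then regs s' 20 = lo \<and> regs s' 21 = mid
         else regs s' 20 = mid \<and> regs s' 21 = hi)"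
    show ?thesis
      unfolding bsearch_loop_def
    proof (rule runs_While_step[where ?Q1.0 = ?Q and ?B1.0 = 20 and ?B2.0 = "30 * f + 10"], goal_cases)
      case 1
      have "1 < hi - lo" using Suc.prems(1) False by linarith
      then show ?case using Suc.prems minus by simp
    next
      case 2
      show ?case
        using Suc.prems plus mid_le a x hi_word mid
        by (simp add: runs_def wp_simps mid_def[symmetric])
    next
      case (3 s')
      show ?case
      proof (cases "regs s x < D ! a ! mid")
        case True
        then show ?thesis
          using Suc.IH[of lo mid s'] 3 mid mid_le Suc.prems x unfolding bsearch_loop_def by auto
      next
        case False
        then show ?thesis
          using Suc.IH[of mid hi s'] 3 mid mid_le Suc.prems x unfolding bsearch_loop_def by auto
      qed
    qed simp
  qed
qed

lemma bsearch_runs: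
  assumes a: "a < length D" "length (D ! a) = r" "\<forall>v\<in>set (D ! a). v \<le> n"
    and x: "x < 20" and s: "regs s 4 = r" "D ! a ! 0 \<le> regs s x"
  shows "runs' (bsearch x a) (30 * lg n + 20)
    (\<lambda>s'. regs s' 20 < r \<and> D ! a ! regs s' 20 \<le> regs s x \<and>
      (Suc (regs s' 20) < r \<longrightarrow> regs s x < D ! a ! Suc (regs s' 20)) \<and>
      (\<forall>y<20. regs s' y = regs s y)) s"
proof -
  let ?s1 = "set_reg w 21 r (set_reg w 20 0 s)"
  have 1: "runs' (Assign 20 (Const 0)) 2 (\<lambda>s'. s' = set_reg w 20 0 s) s"
    by (simp add: runs_def wp_simps)
  have 2: "runs' (Assign 21 (Reg 4)) 2 (\<lambda>s'. s' = ?s1) (set_reg w 20 0 s)"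
    using s by (simp add: runs_def wp_simps)
  have 3: "runs' (bsearch_loop x a) (30 * lg n + 10)
      (\<lambda>s'. regs s' 20 < r \<and> D ! a ! regs s' 20 \<le> regs ?s1 x \<and>
        (Suc (regs s' 20) < r \<longrightarrow> regs ?s1 x < D ! a ! Suc (regs s' 20)) \<and>
        (\<forall>y<20. regs s' y = regs ?s1 y)) ?s1"
    by (rule bsearch_loop[OF a x r_pos order_refl])
      (use r_le_n n_less_lg s x in auto)
  have 4: "runs' (bsearch_loop x a) (30 * lg n + 10)
    (\<lambda>s'. regs s' 20 < r \<and> D ! a ! regs s' 20 \<le> regs s x \<and>
      (Suc (regs s' 20) < r \<longrightarrow> regs s x < D ! a ! Suc (regs s' 20)) \<and>
      (\<forall>y<20. regs s' y = regs s y)) ?s1"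
    by (rule runs_mono[OF 3]) (use x in auto)
  have 5: "runs' (Assign 21 (Reg 4) ;; bsearch_loop x a) (30 * lg n + 12)
    (\<lambda>s'. regs s' 20 < r \<and> D ! a ! regs s' 20 \<le> regs s x \<and>
      (Suc (regs s' 20) < r \<longrightarrow> regs s x < D ! a ! Suc (regs s' 20)) \<and>
      (\<forall>y<20. regs s' y = regs s y)) (set_reg w 20 0 s)"
  proof (rule runs_Seq[OF 2, where ?B2.0 = "30 * lg n + 10"], goal_cases)
    case (1 s')
    then show ?case using 4 by simp
  qed linarith
  show ?thesis
    unfolding bsearch_def
  proof (rule runs_Seq[OF 1, where ?B2.0 = "30 * lg n + 12"], goal_cases)
    case (1 s')
    then show ?case using 5 by simp
  qed simp
qed

text \<open>The value \<open>v\<close> is demanded of every index that the search could return, so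
  callers reason about breakpoints only.\<close>

lemma walk_runs:
  assumes a: "a < length D" "length (D ! a) = r" "\<forall>v\<in>set (D ! a). v \<le> n"
    and b: "b < length D" "length (D ! b) = r"
    and x: "x < 20" "y < 20" and s: "regs s 4 = r" "D ! a ! 0 \<le> regs s x" "regs s x \<le> n"
    and v: "v \<le> n" "\<And>i. i < r \<Longrightarrow> D ! a ! i \<le> regs s x \<Longrightarrow>
      (Suc i < r \<Longrightarrow> regs s x < D ! a ! Suc i) \<Longrightarrow> D ! b ! i + (regs s x - D ! a ! i) = v"
  shows "runs' (walk x y a b) (30 * lg n + 40)
    (\<lambda>s'. regs s' y = v \<and> (\<forall>z<20. z \<noteq> y \<longrightarrow> regs s' z = regs s z)) s"
  unfolding walk_def
proof (rule runs_Seq[OF bsearch_runs[OF a x(1) s(1,2)], where ?B2.0 = 20])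
  fix s' :: state
  assume s': "regs s' 20 < r \<and> D ! a ! regs s' 20 \<le> regs s x \<and>
      (Suc (regs s' 20) < r \<longrightarrow> regs s x < D ! a ! Suc (regs s' 20)) \<and>
      (\<forall>y<20. regs s' y = regs s y)"
  define i where "i = regs s' 20"
  have i: "i < r" "D ! a ! i \<le> regs s x" "D ! b ! i + (regs s x - D ! a ! i) = v"
    using s' v(2)[of i] by (auto simp: i_def)
  have le: "D ! a ! i \<le> n" "D ! b ! i \<le> n" using i s(3) v(1) by linarith+
  have minus: "apply_op w Minus (regs s x) (D ! a ! i) = regs s x - D ! a ! i"
    using i s(3) le_n_word by (intro apply_Minus) auto
  have plus: "apply_op w Plus (D ! b ! i) (regs s x - D ! a ! i) = v"
    using i v(1) le_n_word by (subst apply_Plus) auto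
  show "runs' (Data 21 a (Reg 20) ;; Data 22 b (Reg 20) ;;
      Assign y (Op Plus (Reg 22) (Op Minus (Reg x) (Reg 21)))) 20
      (\<lambda>s'. regs s' y = v \<and> (\<forall>z<20. z \<noteq> y \<longrightarrow> regs s' z = regs s z)) s'"
    using a b x s' i le minus plus v(1) by (simp add: runs_def wp_simps i_def[symmetric])
qed simp

lemma nth_le_sorted_list_of_set:
  fixes X :: "nat set"
  assumes X: "finite X" "y \<in> X" and i: "i < card X"
    and next_gt: "Suc i < card X \<Longrightarrow> y < sorted_list_of_set X ! Suc i"
  shows "y \<le> sorted_list_of_set X ! i"
proof -
  obtain j where j: "j < card X" "sorted_list_of_set X ! j = y"
    using X by (metis in_set_conv_nth length_sorted_list_of_set set_sorted_list_of_set)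
  have "j \<le> i"
  proof (rule ccontr)
    assume "\<not> j \<le> i"
    then have "Suc i \<le> j" "Suc i < card X" using j by auto
    then have "sorted_list_of_set X ! Suc i \<le> y"
      using j sorted_nth_mono[of "sorted_list_of_set X" "Suc i" j] by simp
    then show False using next_gt \<open>Suc i < card X\<close> by simp
  qed
  then show ?thesis using j i sorted_nth_mono[of "sorted_list_of_set X" j i] by simp
qed

text \<open>Treats heads and tails alike. Text position 0 is sampled, so the first entry is 0 and
  the search is defined for every key; the last claim says that the entry found is the closest
  sample at or before \<open>p\<close>.\<close>

lemma sample_list:
  assumes X: "X \<subseteq> {..<n}" "card X = r" "\<forall>q<n. sa q = 0 \<longrightarrow> q \<in> X"
  defines "A \<equiv> sorted_list_of_set (sa ` X)"
  shows "length A = r" "\<forall>v\<in>set A. v \<le> n" "A ! 0 = 0"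
    "i < r \<Longrightarrow> \<exists>q\<in>X. A ! i = sa q"
    "\<lbrakk>i < r; Suc i < r \<Longrightarrow> p < A ! Suc i; h \<in> X; sa h \<le> p\<rbrakk> \<Longrightarrow> sa h \<le> A ! i"
proof -
  have fin: "finite (sa ` X)" using X finite_subset by blast
  have "inj_on sa X" using X(1) sa_eq_iff by (auto simp: inj_on_def)
  then have card: "card (sa ` X) = r" using X(2) by (simp add: card_image)
  have set_A: "set A = sa ` X" using fin by (simp add: A_def)
  show len: "length A = r" by (simp add: A_def card)
  have "sa q < n" if "q \<in> X" for q using that X(1) sa_less by blast
  then show "\<forall>v\<in>set A. v \<le> n" using set_A by fastforce
  show "\<exists>q\<in>X. A ! i = sa q" if "i < r"
    using that len set_A nth_mem[of i A] by auto
  have zero: "0 \<in> sa ` X" using ex_row[of 0] n_pos X(3) by (metis image_eqI)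
  then obtain j where "j < r" "A ! j = 0" using set_A len by (metis in_set_conv_nth)
  then show "A ! 0 = 0"
    using sorted_nth_mono[of A 0 j] len by (simp add: A_def)
  show "sa h \<le> A ! i" if "i < r" "Suc i < r \<Longrightarrow> p < A ! Suc i" "h \<in> X" "sa h \<le> p"
    unfolding A_def
    by (rule nth_le_sorted_list_of_set[OF fin])
      (use that card in \<open>auto simp: A_def intro: le_less_trans\<close>)
qed

lemma head_samples: "heads \<subseteq> {..<n}" "card heads = r" "\<forall>q<n. sa q = 0 \<longrightarrow> q \<in> heads"
  and tail_samples: "tails \<subseteq> {..<n}" "card tails = r" "\<forall>q<n. sa q = 0 \<longrightarrow> q \<in> tails"
  using heads_less tails_less card_heads card_tails text_start_sampled by blast+

lemma D_simps: "length D = 7" "D ! 0 = [n, r]" "D ! Suc 0 = map hd_run [0..<r]"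
    "D ! 2 = map (\<lambda>j. LF T (hd_run j)) [0..<r]"
    "D ! 3 = sorted_list_of_set (sa ` heads)"
    "D ! 4 = map (\<lambda>p. sa (row p - 1)) (sorted_list_of_set (sa ` heads))"
    "D ! 5 = sorted_list_of_set (sa ` tails)"
    "D ! 6 = map (\<lambda>p. if Suc (row p) < n then sa (Suc (row p)) else 0)
      (sorted_list_of_set (sa ` tails))"
  by (simp_all add: D_def)

lemma walk_up_runs:
  assumes x: "x < 20" "y < 20" and s: "regs s 4 = r" "regs s x = sa q" and q: "0 < q" "q < n"
  shows "runs' (walk x y 3 4) (30 * lg n + 40)
    (\<lambda>s'. regs s' y = sa (q - 1) \<and> (\<forall>z<20. z \<noteq> y \<longrightarrow> regs s' z = regs s z)) s"
proof (rule walk_runs)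
  note smp = sample_list[OF head_samples]
  show "D ! 4 ! i + (regs s x - D ! 3 ! i) = sa (q - 1)"
    if i: "i < r" "D ! 3 ! i \<le> regs s x" "Suc i < r \<Longrightarrow> regs s x < D ! 3 ! Suc i" for i
  proof -
    obtain q' where q': "q' \<in> heads" "D ! 3 ! i = sa q'"
      using smp(4)[OF i(1)] by (auto simp: D_simps)
    have "sa (q - 1) = sa (q' - 1) + (sa q - sa q')"
    proof (rule phi_sample[OF q(2,1) q'(1)])
      show "sa q' \<le> sa q" using i q' s by simp
      show "sa h \<le> sa q'" if "h \<in> heads" "sa h \<le> sa q" for h
        using smp(5)[of i "sa q" h] i s that q' by (simp add: D_simps)
    qed
    then show ?thesis using q' i(1) s smp(1) heads_less by (simp add: D_simps)
  qed
qed (use sample_list[OF head_samples] x s q sa_less[of q] sa_less[of "q - 1"] in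
    \<open>simp_all add: D_simps less_imp_le\<close>)

lemma walk_down_runs:
  assumes x: "x < 20" "y < 20" and s: "regs s 4 = r" "regs s x = sa q" and q: "Suc q < n"
  shows "runs' (walk x y 5 6) (30 * lg n + 40)
    (\<lambda>s'. regs s' y = sa (Suc q) \<and> (\<forall>z<20. z \<noteq> y \<longrightarrow> regs s' z = regs s z)) s"
proof (rule walk_runs)
  note smp = sample_list[OF tail_samples]
  show "D ! 6 ! i + (regs s x - D ! 5 ! i) = sa (Suc q)"
    if i: "i < r" "D ! 5 ! i \<le> regs s x" "Suc i < r \<Longrightarrow> regs s x < D ! 5 ! Suc i" for i
  proof -
    obtain q' where q': "q' \<in> tails" "D ! 5 ! i = sa q'"
      using smp(4)[OF i(1)] by (auto simp: D_simps)
    have "Suc q' < n \<and> sa (Suc q) = sa (Suc q') + (sa q - sa q')"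
    proof (rule phi_inv_sample[OF q q'(1)])
      show "sa q' \<le> sa q" using i q' s by simp
      show "sa h \<le> sa q'" if "h \<in> tails" "sa h \<le> sa q" for h
        using smp(5)[of i "sa q" h] i s that q' by (simp add: D_simps)
    qed
    then show ?thesis using q' i(1) s smp(1) tails_less by (simp add: D_simps)
  qed
qed (use sample_list[OF tail_samples] x s q sa_less[of q] sa_less[of "Suc q"] in
    \<open>simp_all add: D_simps less_imp_le\<close>)

section \<open>Growing the window\<close>

definition matched :: "str \<Rightarrow> state \<Rightarrow> bool" where
  "matched S s \<longleftrightarrow> regs s 3 = n \<and> regs s 4 = r \<and> best S (regs s 5) (regs s 7) \<and>
     regs s 6 = sa (regs s 5)"

lemma matched_cong:
  "matched S s \<Longrightarrow> (\<And>z. z \<in> {3..7} \<Longrightarrow> regs s' z = regs s z) \<Longrightarrow> matched S s'"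
  by (simp add: matched_def)

text \<open>By \<open>best_lcp\<close> the match is the minimum of the current length and the LCE,
  which the comparison selects.\<close>

lemma match_len_runs:
  assumes s: "matched S s" "regs s y = sa t" "t < n" and x: "x \<notin> {6, 7}" "x \<noteq> y"
  shows "runs' (match_len x y) (c * lg n + 20)
    (\<lambda>s'. regs s' x = Suc (lcp S (suf t)) \<and> (\<forall>z. z \<noteq> x \<longrightarrow> regs s' z = regs s z)) s"
proof -
  let ?q = "regs s 5" and ?l = "regs s 7"
  have m: "best S ?q ?l" "regs s 6 = sa ?q" "?q < n" using s by (auto simp: matched_def best_def)
  let ?e = "LCE T (sa ?q) (sa t)"
  have l: "lcp S (suf t) = min ?l ?e" using best_lcp[OF m(1) s(3)] .
  have "?e \<le> n - sa t" using lcp_le_length(2)[of "suf ?q" "suf t"] by (simp add: LCE_eq_lcp)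
  then have e: "?e \<le> n" by simp
  have l_n: "?l \<le> n" using best_le_n m by blast
  have plus: "apply_op w Plus v 1 = Suc v" "Suc v mod 2 ^ w = Suc v" if "v \<le> n" for v
    using that word_bound by (simp_all add: apply_Plus)
  have sas: "sa ?q < n" "sa t < n" using sa_less m s by auto
  then have time: "snd (lce_query M (sa ?q) (sa t)) \<le> c * lg n" by (rule lce_time)
  show ?thesis
    unfolding match_len_def
    using s m x sas e l_n l plus[OF e] plus[OF l_n] time
    by (simp add: runs_def wp_simps)
qed

definition win :: "str \<Rightarrow> state \<Rightarrow> bool" where
  "win S s \<longleftrightarrow> matched S s \<and> window S (regs s 10) (regs s 12) (regs s 19) \<and>
     regs s 10 \<le> regs s 5 \<and> regs s 5 \<le> regs s 12 \<and>
     regs s 11 = sa (regs s 10) \<and> regs s 13 = sa (regs s 12)"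

text \<open>One binary search takes about \<open>30 * lg n\<close> and one LCE query at most
  \<open>c * lg n\<close>.\<close>

abbreviation look_bound where "look_bound \<equiv> (30 + c) * lg n + 70"

lemma look_up_runs:
  assumes s: "win S s"
  shows "runs' look_up look_bound
    (\<lambda>s'. regs s' 15 = (if regs s 10 = 0 then 0 else Suc (lcp S (suf (regs s 10 - 1)))) \<and>
      (0 < regs s 10 \<longrightarrow> regs s' 17 = sa (regs s 10 - 1)) \<and>
      (\<forall>z<20. z \<notin> {15, 17} \<longrightarrow> regs s' z = regs s z)) s"
  (is "runs' _ _ ?Q s")
  unfolding look_up_def
proof (rule runs_Cond[where ?B1.0 = "look_bound - 5"])
  let ?a = "regs s 10"
  assume "eval w (Reg 10) s \<noteq> 0"
  then have a: "0 < ?a" "?a < n" using s by (auto simp: win_def window_def)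
  show "runs' (walk 11 17 3 4 ;; match_len 15 17) (look_bound - 5) ?Q s"
  proof (rule runs_Seq[OF walk_up_runs[of 11 17 s ?a]])
    fix s' :: state assume s': "regs s' 17 = sa (?a - 1) \<and> (\<forall>z<20. z \<noteq> 17 \<longrightarrow> regs s' z = regs s z)"
    have "matched S s'" using s s' by (auto simp: win_def intro: matched_cong)
    then show "runs' (match_len 15 17) (c * lg n + 20) ?Q s'"
      by (rule runs_mono[OF match_len_runs[of S s' 17 "?a - 1"]]) (use s' a in auto)
  qed (use s a in \<open>simp_all add: win_def matched_def algebra_simps\<close>)
next
  assume "eval w (Reg 10) s = 0"
  then show "runs' (Assign 15 (Const 0)) (look_bound - 5) ?Q s"
    by (simp add: runs_def wp_simps)
qed simp

lemma look_down_runs: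
  assumes s: "win S s"
  shows "runs' look_down look_bound
    (\<lambda>s'. regs s' 16 = (if Suc (regs s 12) < n then Suc (lcp S (suf (Suc (regs s 12)))) else 0) \<and>
      (Suc (regs s 12) < n \<longrightarrow> regs s' 18 = sa (Suc (regs s 12))) \<and>
      (\<forall>z<20. z \<notin> {16, 18} \<longrightarrow> regs s' z = regs s z)) s"
  (is "runs' _ _ ?Q s")
  unfolding look_down_def
proof (rule runs_Cond[where ?B1.0 = "look_bound - 10"])
  let ?b = "regs s 12"
  have b: "?b < n" using s by (auto simp: win_def window_def)
  then have "apply_op w Plus ?b 1 = Suc ?b" using word_bound by (simp add: apply_Plus)
  then have ev: "eval w (Op Less (inc 12) (Reg 3)) s = (if Suc ?b < n then 1 else 0)"
    using s by (simp add: win_def matched_def)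
  {
    assume "eval w (Op Less (inc 12) (Reg 3)) s \<noteq> 0"
    then have lt: "Suc ?b < n" using ev by (simp split: if_splits)
    show "runs' (walk 13 18 5 6 ;; match_len 16 18) (look_bound - 10) ?Q s"
    proof (rule runs_Seq[OF walk_down_runs[of 13 18 s ?b]])
      fix s' :: state assume s': "regs s' 18 = sa (Suc ?b) \<and> (\<forall>z<20. z \<noteq> 18 \<longrightarrow> regs s' z = regs s z)"
      have "matched S s'" using s s' by (auto simp: win_def intro: matched_cong)
      then show "runs' (match_len 16 18) (c * lg n + 20) ?Q s'"
        by (rule runs_mono[OF match_len_runs[of S s' 18 "Suc ?b"]]) (use s' lt in auto)
    qed (use s lt in \<open>simp_all add: win_def matched_def algebra_simps\<close>)
  next
    assume "eval w (Op Less (inc 12) (Reg 3)) s = 0"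
    then have "\<not> Suc ?b < n" using ev by (simp split: if_splits)
    then show "runs' (Assign 16 (Const 0)) (look_bound - 10) ?Q s"
      by (simp add: runs_def wp_simps)
  }
qed simp

lemma widen_runs:
  assumes s: "win S s" and proper: "Suc (regs s 12 - regs s 10) < n" and cnt: "0 < regs s 14" "regs s 14 \<le> n"
  shows "runs' widen (2 * look_bound + 50)
    (\<lambda>s'. win S s' \<and> regs s' 12 - regs s' 10 = Suc (regs s 12 - regs s 10) \<and>
      regs s' 14 = regs s 14 - 1 \<and> (\<forall>z<10. regs s' z = regs s z)) s"
  (is "runs' _ _ ?Q s")
  unfolding widen_def
proof (rule runs_Seq[OF look_up_runs[OF s], where ?B2.0 = "look_bound + 40"])
  let ?a = "regs s 10" and ?b = "regs s 12"
  fix s1 :: state assume s1: "regs s1 15 = (if ?a = 0 then 0 else Suc (lcp S (suf (?a - 1)))) \<and>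
      (0 < ?a \<longrightarrow> regs s1 17 = sa (?a - 1)) \<and> (\<forall>z<20. z \<notin> {15, 17} \<longrightarrow> regs s1 z = regs s z)"
  have "matched S s1" using s s1 by (auto simp: win_def intro: matched_cong)
  then have win1: "win S s1" using s s1 by (simp add: win_def)
  have cnt': "regs s 14 - 1 \<le> n" using cnt by simp
  show "runs' (look_down ;; (Cond (Op Less (Reg 15) (Reg 16))
       (Assign 12 (inc 12) ;; Assign 13 (Reg 18) ;; Assign 19 (dec 16))
       (Assign 10 (dec 10) ;; Assign 11 (Reg 17) ;; Assign 19 (dec 15)) ;;
     Assign 14 (dec 14))) (look_bound + 40) ?Q s1"
  proof (rule runs_Seq[OF look_down_runs[OF win1], where ?B2.0 = 40])
    fix s2 :: state assume "regs s2 16 = (if Suc (regs s1 12) < n then Suc (lcp S (suf (Suc (regs s1 12)))) else 0) \<and>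
        (Suc (regs s1 12) < n \<longrightarrow> regs s2 18 = sa (Suc (regs s1 12))) \<and>
        (\<forall>z<20. z \<notin> {16, 18} \<longrightarrow> regs s2 z = regs s1 z)"
    then have s2: "regs s2 16 = (if Suc ?b < n then Suc (lcp S (suf (Suc ?b))) else 0)"
        "Suc ?b < n \<longrightarrow> regs s2 18 = sa (Suc ?b)"
        "regs s2 15 = (if ?a = 0 then 0 else Suc (lcp S (suf (?a - 1))))"
        "0 < ?a \<longrightarrow> regs s2 17 = sa (?a - 1)"
        "\<forall>z<20. z \<notin> {15, 16, 17, 18} \<longrightarrow> regs s2 z = regs s z"
      using s1 by auto
    have ab: "?a \<le> ?b" "?b < n" "?a \<le> regs s 5" "regs s 5 \<le> ?b"
        "best S (regs s 5) (regs s 7)" "window S ?a ?b (regs s 19)"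
      using s by (auto simp: win_def window_def matched_def)
    have le: "lcp S (suf t) \<le> n" for t
      using lcp_le_length(2)[of S "suf t"] by (simp add: le_diff_conv)
    have inc: "apply_op w Plus v 1 = Suc v" if "v < n" for v
      using that word_bound by (simp add: apply_Plus)
    have dec: "apply_op w Minus (Suc v) 1 = v" if "v \<le> n" for v
      using that word_bound by (simp add: apply_Minus)
    have dec': "apply_op w Minus v 1 = v - 1" if "0 < v" "v \<le> n" for v
      using that word_bound by (simp add: apply_Minus)
    have matched: "matched S s'" if "\<And>z. z \<in> {3..7} \<Longrightarrow> regs s' z = regs s z" for s'
      using matched_cong[of S s s'] s that by (simp add: win_def)
    show "runs' (Cond (Op Less (Reg 15) (Reg 16))
         (Assign 12 (inc 12) ;; Assign 13 (Reg 18) ;; Assign 19 (dec 16))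
         (Assign 10 (dec 10) ;; Assign 11 (Reg 17) ;; Assign 19 (dec 15)) ;;
       Assign 14 (dec 14)) 40 ?Q s2"
    proof (cases "regs s2 15 < regs s2 16")
      case True
      then have lt: "Suc ?b < n" using s2(1) by (simp split: if_splits)
      have "lcp S (suf (?a - 1)) \<le> lcp S (suf (Suc ?b))" if "0 < ?a"
        using True s2(1,3) lt that by simp
      from window_down[OF ab(5,6,3,4) lt this]
      show ?thesis
        using True s2 lt ab cnt le[of "Suc ?b"] inc[OF ab(2)] dec[OF le[of "Suc ?b"]] dec'[OF cnt] s
          sa_less[OF lt] cnt'
        by (simp add: runs_def wp_simps win_def matched_def Suc_diff_le)
    next
      case False
      \<comment> \<open>Some row lies outside the window. If none lies above, the one below has a
        positive incremented length against 0, and the test would have chosen it.\<close>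
      have a: "0 < ?a"
      proof (rule ccontr)
        assume "\<not> 0 < ?a"
        then have "Suc ?b < n" "?a = 0" using proper by auto
        then show False using False s2(1,3) by simp
      qed
      have "lcp S (suf (Suc ?b)) \<le> lcp S (suf (?a - 1))" if "Suc ?b < n"
        using False s2(1,3) a that by simp
      note window = window_up[OF ab(5,6,3,4) a this]
      have "?a \<le> n" "?a - 1 < n" using ab by linarith+
      then have a_n: "?a \<le> n" "?a - 1 \<le> n" "sa (?a - 1) \<le> n"
        using sa_less[of "?a - 1"] by linarith+
      have size: "?b - (?a - 1) = Suc (?b - ?a)" "?a - 1 \<le> regs s 5" using a ab by simp_all
      show ?thesis
        using False s2 a ab(1-4) cnt le[of "?a - 1"] dec'[OF a a_n(1)] dec[OF le[of "?a - 1"]]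
          dec'[OF cnt] s a_n size window cnt'
        by (simp add: runs_def wp_simps win_def matched_def)
    qed
  qed simp
qed simp

text \<open>After \<open>m\<close> more rounds the window has as many rows as the argument of
  \<open>ms\<close> states, and \<open>window_ms\<close> identifies its worst match.\<close>

lemma while_widen_runs:
  "win S s \<Longrightarrow> regs s 14 = m \<Longrightarrow> regs s 12 - regs s 10 + m < n \<Longrightarrow>
    runs' (While (Reg 14) widen) (m * (2 * look_bound + 60) + 10)
      (\<lambda>s'. regs s' 19 = ms (Suc (regs s 12 - regs s 10 + m)) S \<and> (\<forall>z<10. regs s' z = regs s z)) s"
proof (induction m arbitrary: s)
  case 0
  have "ms (Suc (regs s 12 - regs s 10)) S = regs s 19"
    using 0 window_ms by (auto simp: win_def)
  then show ?case using 0 by (intro runs_While_done) auto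
next
  case (Suc m)
  have "Suc (regs s 12 - regs s 10) < n" "0 < regs s 14" "regs s 14 \<le> n"
    using Suc.prems by linarith+
  note widen = widen_runs[OF Suc.prems(1) this]
  show ?case
  proof (rule runs_While_step[OF _ widen, where ?B2.0 = "m * (2 * look_bound + 60) + 10"])
    show "eval w (Reg 14) s \<noteq> 0" using Suc.prems by simp
    fix s1 :: state
    assume s1: "win S s1 \<and> regs s1 12 - regs s1 10 = Suc (regs s 12 - regs s 10) \<and>
      regs s1 14 = regs s 14 - 1 \<and> (\<forall>z<10. regs s1 z = regs s z)"
    show "runs' (While (Reg 14) widen) (m * (2 * look_bound + 60) + 10)
      (\<lambda>s'. regs s' 19 = ms (Suc (regs s 12 - regs s 10 + Suc m)) S \<and>
        (\<forall>z<10. regs s' z = regs s z)) s1"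
      by (rule runs_mono[OF Suc.IH[of s1]]) (use s1 Suc.prems in auto)
  qed simp
qed

lemma compute_ms_runs:
  assumes s: "matched S s" and k: "1 \<le> regs s 0" "regs s 0 < 2 ^ w"
  shows "runs' compute_ms (regs s 0 * (2 * look_bound + 60) + 50)
    (\<lambda>s'. regs s' 19 = ms (regs s 0) S \<and> (\<forall>z<10. regs s' z = regs s z)) s"
  (is "runs' _ _ ?Q s")
  unfolding compute_ms_def
proof (rule runs_Cond[where ?B1.0 = "regs s 0 * (2 * look_bound + 60) + 40"])
  let ?q = "regs s 5" and ?k = "regs s 0"
  have q: "regs s 3 = n" "best S ?q (regs s 7)" "regs s 6 = sa ?q" "?q < n" "regs s 7 \<le> n"
    using s best_le_n[of S ?q "regs s 7"] by (auto simp: matched_def best_def)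
  have ev: "eval w (Op Less (Reg 3) (Reg 0)) s = (if n < ?k then 1 else 0)"
    using q by simp
  {
    assume "eval w (Op Less (Reg 3) (Reg 0)) s \<noteq> 0"
    then have "n < ?k" using ev by (simp split: if_splits)
    then show "runs' (Assign 19 (Const 0)) (?k * (2 * look_bound + 60) + 40) ?Q s"
      by (simp add: runs_def wp_simps ms_large)
  next
    assume "eval w (Op Less (Reg 3) (Reg 0)) s = 0"
    then have k_n: "?k \<le> n" using ev by (simp split: if_splits)
    let ?Q1 = "\<lambda>s'. win S s' \<and> regs s' 14 = ?k - 1 \<and> regs s' 10 = regs s' 12 \<and>
      (\<forall>z<10. regs s' z = regs s z)"
    have dec: "apply_op w Minus ?k 1 = ?k - 1" using k by (intro apply_Minus)
    have "?k - 1 \<le> n" "sa ?q \<le> n" "?q \<le> n" using k_n q sa_less[of ?q] by auto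
    then have 1: "runs' (Assign 10 (Reg 5) ;; Assign 11 (Reg 6) ;; Assign 12 (Reg 5) ;;
       Assign 13 (Reg 6) ;; Assign 19 (Reg 7) ;; Assign 14 (dec 0)) 20 ?Q1 s"
      using s q k_n dec window_init[OF q(2)]
      by (simp add: runs_def wp_simps win_def matched_def)
    show "runs' ((Assign 10 (Reg 5) ;; Assign 11 (Reg 6) ;; Assign 12 (Reg 5) ;;
       Assign 13 (Reg 6) ;; Assign 19 (Reg 7) ;; Assign 14 (dec 0)) ;; While (Reg 14) widen)
       (?k * (2 * look_bound + 60) + 40) ?Q s"
    proof (rule runs_Seq[OF 1, where ?B2.0 = "?k * (2 * look_bound + 60) + 10"])
      fix s' :: state
      assume s': "?Q1 s'"
      show "runs' (While (Reg 14) widen) (?k * (2 * look_bound + 60) + 10) ?Q s'"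
      proof (rule runs_mono[OF while_widen_runs[of S s' "?k - 1"]])
        show "regs s' 12 - regs s' 10 + (?k - 1) < n" using s' k_n k by simp
        show "(?k - 1) * (2 * look_bound + 60) + 10 \<le> ?k * (2 * look_bound + 60) + 10"
          by (intro add_right_mono mult_right_mono) simp_all
      qed (use s' k in auto)
    qed linarith
  }
qed simp

section \<open>Choosing a row that precedes the next symbol\<close>

definition scan :: "nat \<Rightarrow> str \<Rightarrow> state \<Rightarrow> bool" where
  "scan x S s \<longleftrightarrow> matched S s \<and> regs s 1 = x \<and> regs s 10 < r \<and>
     hd_run (regs s 10) \<le> regs s 5 \<and> regs s 5 \<le> tl_run (regs s 10) \<and> bwt (regs s 5) \<noteq> x \<and>
     regs s 13 = run_rank T x (regs s 10) \<and> regs s 14 = run_rank T x r"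

text \<open>In the context of \<open>scan\<close>, the second branch provides the hypotheses of
  \<open>run_above\<close> on the selected run.\<close>

definition found_up :: "nat \<Rightarrow> str \<Rightarrow> state \<Rightarrow> bool" where
  "found_up x S s \<longleftrightarrow> (if regs s 13 = 0 then regs s 15 = 0
     else let i = regs s 17 in i < r \<and> bwt (hd_run i) = x \<and> Suc (run_rank T x i) = regs s 13 \<and>
       regs s 11 = sa (tl_run i) \<and> regs s 15 = Suc (lcp S (suf (tl_run i))))"

definition found_down :: "nat \<Rightarrow> str \<Rightarrow> state \<Rightarrow> bool" where
  "found_down x S s \<longleftrightarrow> (if regs s 13 = regs s 14 then regs s 16 = 0
     else let i = regs s 18 in i < r \<and> bwt (hd_run i) = x \<and> run_rank T x i = regs s 13 \<and>
       regs s 19 = sa (hd_run i) \<and> regs s 16 = Suc (lcp S (suf (hd_run i))))"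

text \<open>The interface between \<open>find_row\<close> and \<open>extend\<close>: it supplies the
  hypotheses of \<open>best_absent\<close> if register 12 is 0 and of \<open>best_extend\<close>
  otherwise.\<close>

definition found :: "nat \<Rightarrow> str \<Rightarrow> state \<Rightarrow> bool" where
  "found x S s \<longleftrightarrow> regs s 3 = n \<and> regs s 4 = r \<and> regs s 5 < n \<and> regs s 6 = sa (regs s 5) \<and>
     (if regs s 12 = 0 then regs s 7 = 0 \<and> (\<forall>t<n. bwt t \<noteq> x)
      else regs s 10 < r \<and> hd_run (regs s 10) \<le> regs s 5 \<and> regs s 5 \<le> tl_run (regs s 10) \<and>
        bwt (regs s 5) = x \<and> regs s 7 = lcp S (suf (regs s 5)) \<and>
        (\<forall>t<n. bwt t = x \<longrightarrow> lcp S (suf t) \<le> regs s 7))"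

lemma cand_up_runs:
  assumes s: "scan x S s"
  shows "runs' cand_up (2 * c * lg n + 40)
    (\<lambda>s'. found_up x S s' \<and> (\<forall>z<20. z \<notin> {11, 15, 17} \<longrightarrow> regs s' z = regs s z)) s"
  (is "runs' _ _ ?Q s")
  unfolding cand_up_def
proof (rule runs_Cond[where ?B1.0 = "2 * c * lg n + 35"])
  let ?k = "regs s 13"
  let ?i = "fst (wt_select M x (?k - 1))"
  have k_le: "?k \<le> run_rank T x r" "regs s 1 = x"
    using s run_rank_mono[of "regs s 10" r x] by (auto simp: scan_def)
  assume "eval w (Reg 13) s \<noteq> 0"
  then have k: "0 < ?k" by simp
  then have lt: "?k - 1 < run_rank T x r" using k_le by simp
  note sel = select[OF lt]
  have k_n: "?k \<le> n" using k_le run_rank_le[of x r] r_le_n by linarith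
  have dec: "apply_op w Minus ?k 1 = ?k - 1" using k k_n le_n_word[of ?k] by (intro apply_Minus) auto
  let ?Q1 = "\<lambda>s'. regs s' 17 = ?i \<and> regs s' 11 = sa (tl_run ?i) \<and>
    (\<forall>z<20. z \<notin> {11, 17} \<longrightarrow> regs s' z = regs s z)"
  have tl: "tl_run ?i < n" using tl_run_less[OF sel(1)] .
  have "?i \<le> n" "sa (tl_run ?i) \<le> n"
    using sel(1) r_le_n sa_less[OF tl] by linarith+
  then have 1: "runs' (Select 17 (Reg 1) (dec 13) ;; Table 11 SA_Tail (Reg 17)) (c * lg n + 12) ?Q1 s"
    using sel dec k_le by (simp add: runs_def wp_simps)
  show "runs' ((Select 17 (Reg 1) (dec 13) ;; Table 11 SA_Tail (Reg 17)) ;; match_len 15 11)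
    (2 * c * lg n + 35) ?Q s"
  proof (rule runs_Seq[OF 1, where ?B2.0 = "c * lg n + 20"])
    fix s' :: state
    assume s': "?Q1 s'"
    have "matched S s'" using s s' by (auto simp: scan_def intro: matched_cong)
    then show "runs' (match_len 15 11) (c * lg n + 20) ?Q s'"
      by (rule runs_mono[OF match_len_runs[of S s' 11 "tl_run ?i"]])
        (use s' tl sel k in \<open>auto simp: found_up_def Let_def\<close>)
  qed simp
next
  assume "eval w (Reg 13) s = 0"
  then show "runs' (Assign 15 (Const 0)) (2 * c * lg n + 35) ?Q s"
    by (simp add: runs_def wp_simps found_up_def)
qed simp

lemma cand_down_runs:
  assumes s: "scan x S s"
  shows "runs' cand_down (2 * c * lg n + 40)
    (\<lambda>s'. found_down x S s' \<and> (\<forall>z<20. z \<notin> {16, 18, 19} \<longrightarrow> regs s' z = regs s z)) s"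
  (is "runs' _ _ ?Q s")
  unfolding cand_down_def
proof (rule runs_Cond[where ?B1.0 = "2 * c * lg n + 35"])
  let ?k = "regs s 13"
  let ?i = "fst (wt_select M x ?k)"
  have x: "regs s 1 = x" "regs s 14 = run_rank T x r" "?k \<le> run_rank T x r"
    using s run_rank_mono[of "regs s 10" r x] by (auto simp: scan_def)
  {
    assume "eval w (Op Less (Reg 13) (Reg 14)) s \<noteq> 0"
    then have lt: "?k < run_rank T x r" using x by (simp split: if_splits)
    note sel = select[OF lt]
    let ?Q1 = "\<lambda>s'. regs s' 18 = ?i \<and> regs s' 19 = sa (hd_run ?i) \<and>
      (\<forall>z<20. z \<notin> {18, 19} \<longrightarrow> regs s' z = regs s z)"
    have hd: "hd_run ?i < n" using hd_run_less[OF sel(1)] .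
    have "?i \<le> n" "sa (hd_run ?i) \<le> n"
      using sel(1) r_le_n sa_less[OF hd] by linarith+
    then have 1: "runs' (Select 18 (Reg 1) (Reg 13) ;; Table 19 SA_Head (Reg 18)) (c * lg n + 12) ?Q1 s"
      using sel x by (simp add: runs_def wp_simps)
    show "runs' ((Select 18 (Reg 1) (Reg 13) ;; Table 19 SA_Head (Reg 18)) ;; match_len 16 19)
      (2 * c * lg n + 35) ?Q s"
    proof (rule runs_Seq[OF 1, where ?B2.0 = "c * lg n + 20"])
      fix s' :: state
      assume s': "?Q1 s'"
      have "matched S s'" using s s' by (auto simp: scan_def intro: matched_cong)
      then show "runs' (match_len 16 19) (c * lg n + 20) ?Q s'"
        by (rule runs_mono[OF match_len_runs[of S s' 19 "hd_run ?i"]])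
          (use s' hd sel lt x in \<open>auto simp: found_down_def Let_def\<close>)
    qed simp
  next
    assume "eval w (Op Less (Reg 13) (Reg 14)) s = 0"
    then have "?k = run_rank T x r" using x by (simp split: if_splits)
    then show "runs' (Assign 16 (Const 0)) (2 * c * lg n + 35) ?Q s"
      using x by (simp add: runs_def wp_simps found_down_def)
  }
qed simp

text \<open>Matches decrease away from the best row, so the nearest candidate on each side dominates
  its side. The inequality is strict because lengths are stored incremented; if both registers are 0
  it says that the symbol is absent.\<close>

lemma candidates_complete:
  assumes s: "scan x S s" "found_up x S s" "found_down x S s" and t: "t < n" "bwt t = x"
  shows "lcp S (suf t) < max (regs s 15) (regs s 16)"
proof -
  let ?q = "regs s 5" and ?j = "regs s 10"
  have j: "?j < r" "hd_run ?j \<le> ?q" "?q \<le> tl_run ?j" "bwt ?q \<noteq> x"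
    and rank: "regs s 13 = run_rank T x ?j" "regs s 14 = run_rank T x r"
    and best: "best S ?q (regs s 7)"
    using s by (auto simp: scan_def matched_def)
  consider "t < ?q" | "?q < t" using t j by (metis linorder_neqE_nat)
  then show ?thesis
  proof cases
    case 1
    then have "run_rank T x ?j \<noteq> 0" using no_run_above[OF j _ 1] t by blast
    then have i: "regs s 17 < r" "bwt (hd_run (regs s 17)) = x"
        "Suc (run_rank T x (regs s 17)) = run_rank T x ?j"
        "regs s 15 = Suc (lcp S (suf (tl_run (regs s 17))))"
      using s(2) rank by (auto simp: found_up_def Let_def)
    have "lcp S (suf t) \<le> lcp S (suf (tl_run (regs s 17)))"
      using best_mono_above[OF best] run_above[OF j i(1-3)] 1 t by (simp add: less_imp_le)
    then show ?thesis using i(4) by linarith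
  next
    case 2
    then have "run_rank T x ?j \<noteq> run_rank T x r" using no_run_below[OF j _ 2] t by blast
    then have i: "regs s 18 < r" "bwt (hd_run (regs s 18)) = x"
        "run_rank T x (regs s 18) = run_rank T x ?j"
        "regs s 16 = Suc (lcp S (suf (hd_run (regs s 18))))"
      using s(3) rank by (auto simp: found_down_def Let_def)
    have "lcp S (suf t) \<le> lcp S (suf (hd_run (regs s 18)))"
      using best_mono_below[OF best] run_below[OF j i(1-3)] 2 t by (simp add: less_imp_le)
    then show ?thesis using i(4) by linarith
  qed
qed

abbreviation frame where
  "frame s s' \<equiv> \<forall>z\<in>{0, 1, 2, 8}. regs s' z = regs s z"

lemma choose_row_runs:
  assumes s: "scan x S s" "found_up x S s" "found_down x S s"
  shows "runs' choose_row 40 (\<lambda>s'. found x S s' \<and> frame s s') s"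
proof -
  note complete = candidates_complete[OF s]
  have regs: "regs s 3 = n" "regs s 4 = r" "regs s 5 < n" "regs s 6 = sa (regs s 5)"
    using s by (auto simp: scan_def matched_def best_def)
  have le: "lcp S (suf t) \<le> n" for t
    using lcp_le_length(2)[of S "suf t"] by (simp add: le_diff_conv)
  have dec: "apply_op w Minus (Suc v) 1 = v" if "v \<le> n" for v
    using that word_bound by (simp add: apply_Minus)
  consider (down) "regs s 15 < regs s 16" | (up) "\<not> regs s 15 < regs s 16" "regs s 15 \<noteq> 0"
    | (none) "regs s 15 = 0" "regs s 16 = 0"
    by linarith
  then show ?thesis
  proof cases
    case down
    let ?i = "regs s 18"
    have i: "?i < r" "bwt (hd_run ?i) = x" "regs s 19 = sa (hd_run ?i)"
        "regs s 16 = Suc (lcp S (suf (hd_run ?i)))"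
      using s(3) down by (auto simp: found_down_def Let_def split: if_splits)
    have "\<forall>t<n. bwt t = x \<longrightarrow> lcp S (suf t) \<le> lcp S (suf (hd_run ?i))"
      using complete down i(4) by (metis less_Suc_eq_le max.absorb2 less_imp_le)
    moreover have "hd_run ?i < n" "?i \<le> n" using i hd_run_less r_le_n by auto
    moreover from this have "sa (hd_run ?i) \<le> n" using sa_less by (simp add: less_imp_le)
    ultimately show ?thesis
      unfolding choose_row_def
      using down i le dec[OF le[of "hd_run ?i"]] regs hd_le_tl[OF i(1)]
      by (simp add: runs_def wp_simps found_def)
  next
    case up
    let ?i = "regs s 17"
    have i: "?i < r" "bwt (hd_run ?i) = x" "regs s 11 = sa (tl_run ?i)"
        "regs s 15 = Suc (lcp S (suf (tl_run ?i)))"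
      using s(2) up by (auto simp: found_up_def Let_def split: if_splits)
    have "\<forall>t<n. bwt t = x \<longrightarrow> lcp S (suf t) \<le> lcp S (suf (tl_run ?i))"
      using complete up i(4) by (metis less_Suc_eq_le max.absorb1 not_less)
    moreover have "tl_run ?i < n" "?i \<le> n" using i tl_run_less r_le_n by auto
    moreover from this have "sa (tl_run ?i) \<le> n" using sa_less by (simp add: less_imp_le)
    moreover have "bwt (tl_run ?i) = x" using BWT_run[OF i(1) hd_le_tl[OF i(1)] order_refl] i(2) by simp
    ultimately show ?thesis
      unfolding choose_row_def
      using up i le dec[OF le[of "tl_run ?i"]] regs hd_le_tl[OF i(1)]
      by (simp add: runs_def wp_simps found_def)
  next
    case none
    have "\<forall>t<n. bwt t \<noteq> x" using complete none by fastforce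
    then show ?thesis
      unfolding choose_row_def
      using none regs by (simp add: runs_def wp_simps found_def)
  qed
qed

text \<open>The term \<open>7 * c\<close> accounts for one access, two ranks, two selects and two
  LCE queries.\<close>

lemma find_row_runs:
  assumes s: "matched S s" "regs s 1 = x" "x < 2 ^ w"
  shows "runs' find_row ((30 + 7 * c) * lg n + 250) (\<lambda>s'. found x S s' \<and> frame s s') s"
  (is "runs' _ _ ?Q s")
  unfolding find_row_def
proof (rule runs_Seq[where ?B1.0 = "30 * lg n + 20" and ?B2.0 = "7 * c * lg n + 230"])
  let ?q = "regs s 5"
  have q: "?q < n" "best S ?q (regs s 7)" "regs s 3 = n" "regs s 4 = r" "regs s 6 = sa ?q"
    using s by (auto simp: matched_def best_def)
  let ?Q1 = "\<lambda>s'. regs s' 20 < r \<and> hd_run (regs s' 20) \<le> ?q \<and> ?q \<le> tl_run (regs s' 20) \<and>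
      (\<forall>y<20. regs s' y = regs s y)"
  \<comment> \<open>The binary search requires its first entry not to exceed the key.\<close>
  have "hd_run 0 = 0"
  proof -
    have "0 \<in> heads" using n_pos by (auto simp: heads_eq)
    then obtain j where j: "j < r" "hd_run j = 0" by (auto simp: heads_image)
    then show ?thesis using hd_run_mono[of 0 j] by (cases "j = 0") auto
  qed
  then show "runs' (bsearch 5 1) (30 * lg n + 20) ?Q1 s"
    by (intro runs_mono[OF bsearch_runs])
      (use q r_pos hd_run_less run_of_row[of ?q] in \<open>auto simp: D_simps(1,3) less_imp_le\<close>)
  fix s1 :: state
  assume s1: "?Q1 s1"
  let ?j = "regs s1 20"
  have j: "?j < r" "hd_run ?j \<le> ?q" "?q \<le> tl_run ?j" "?j \<le> n" using s1 r_le_n by auto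
  have bwt_j: "bwt (hd_run ?j) = bwt ?q" using BWT_run[of ?j ?q] j by simp
  let ?Q2 = "\<lambda>s'. regs s' 10 = ?j \<and> regs s' 11 = bwt ?q \<and>
    (\<forall>z<20. z \<notin> {10, 11} \<longrightarrow> regs s' z = regs s z)"
  have 1: "runs' (Assign 10 (Reg 20) ;; Access 11 (Reg 10)) (c * lg n + 10) ?Q2 s1"
    using j s1 bwt_j access_time[OF j(1)] bwt_word[OF q(1)] by (simp add: runs_def wp_simps)
  show "runs' ((Assign 10 (Reg 20) ;; Access 11 (Reg 10)) ;;
     Cond (Op Eq (Reg 11) (Reg 1)) (Assign 12 (Const 1))
      ((Rank 13 (Reg 1) (Reg 10) ;; Rank 14 (Reg 1) (Reg 4)) ;; cand_up ;; cand_down ;; choose_row))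
     (7 * c * lg n + 230) ?Q s1"
  proof (rule runs_Seq[OF 1, where ?B2.0 = "6 * c * lg n + 200"])
    fix s2 :: state
    assume s2: "?Q2 s2"
    have m2: "matched S s2" using s s2 by (auto intro: matched_cong)
    have ev: "eval w (Op Eq (Reg 11) (Reg 1)) s2 = (if bwt ?q = x then 1 else 0)"
      using s2 s by simp
    show "runs' (Cond (Op Eq (Reg 11) (Reg 1)) (Assign 12 (Const 1))
      ((Rank 13 (Reg 1) (Reg 10) ;; Rank 14 (Reg 1) (Reg 4)) ;; cand_up ;; cand_down ;; choose_row))
      (6 * c * lg n + 200) ?Q s2"
    proof (rule runs_Cond[where ?B1.0 = "6 * c * lg n + 190"])
      assume "eval w (Op Eq (Reg 11) (Reg 1)) s2 \<noteq> 0"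
      then have "bwt ?q = x" using ev by (simp split: if_splits)
      then show "runs' (Assign 12 (Const 1)) (6 * c * lg n + 190) ?Q s2"
        using s2 j q by (simp add: runs_def wp_simps found_def best_def)
    next
      assume "eval w (Op Eq (Reg 11) (Reg 1)) s2 = 0"
      then have neq: "bwt ?q \<noteq> x" using ev by (simp split: if_splits)
      have ranks: "run_rank T x ?j \<le> n" "run_rank T x r \<le> n"
        using run_rank_le[of x ?j] run_rank_le[of x r] j r_le_n by linarith+
      have times: "snd (wt_rank M x ?j) \<le> c * lg n" "snd (wt_rank M x r) \<le> c * lg n"
        using rank_time j by simp_all
      let ?Q3 = "\<lambda>s'. scan x S s' \<and> (\<forall>z<20. z \<notin> {10, 11, 13, 14} \<longrightarrow> regs s' z = regs s z)"
      have 2: "runs' (Rank 13 (Reg 1) (Reg 10) ;; Rank 14 (Reg 1) (Reg 4)) (2 * c * lg n + 10) ?Q3 s2"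
        using s2 s q ranks times j neq
        by (simp add: runs_def wp_simps scan_def matched_def)
      show "runs' ((Rank 13 (Reg 1) (Reg 10) ;; Rank 14 (Reg 1) (Reg 4)) ;; cand_up ;; cand_down ;;
        choose_row) (6 * c * lg n + 190) ?Q s2"
      proof (rule runs_Seq[OF 2, where ?B2.0 = "4 * c * lg n + 130"])
        fix s3 :: state
        assume s3: "?Q3 s3"
        then have scan3: "scan x S s3" by blast
        show "runs' (cand_up ;; cand_down ;; choose_row) (4 * c * lg n + 130) ?Q s3"
        proof (rule runs_Seq[OF cand_up_runs[OF scan3], where ?B2.0 = "2 * c * lg n + 90"])
          fix s4 :: state
          assume s4: "found_up x S s4 \<and> (\<forall>z<20. z \<notin> {11, 15, 17} \<longrightarrow> regs s4 z = regs s3 z)"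
          have scan4: "scan x S s4" using scan3 s4 by (simp add: scan_def matched_def)
          show "runs' (cand_down ;; choose_row) (2 * c * lg n + 90) ?Q s4"
          proof (rule runs_Seq[OF cand_down_runs[OF scan4], where ?B2.0 = 40])
            fix s5 :: state
            assume s5: "found_down x S s5 \<and> (\<forall>z<20. z \<notin> {16, 18, 19} \<longrightarrow> regs s5 z = regs s4 z)"
            have scan5: "scan x S s5" using scan4 s5 by (simp add: scan_def matched_def)
            have "\<forall>z\<in>{11, 13, 15, 17}. regs s5 z = regs s4 z" using s5 by simp
            moreover have "found_up x S s4" using s4 by blast
            ultimately have "found_up x S s5"
              by (cases "regs s4 13 = 0") (auto simp: found_up_def Let_def)
            then show "runs' choose_row 40 ?Q s5"
              by (intro runs_mono[OF choose_row_runs[of x S s5]]) (use scan5 s3 s4 s5 in auto)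
          qed linarith
        qed linarith
      qed linarith
    qed simp
  qed linarith
qed (simp add: algebra_simps)

lemma extend_runs:
  assumes s: "found x S s"
  shows "runs' extend 50 (\<lambda>s'. matched (x # S) s' \<and> frame s s') s"
proof (cases "regs s 12 = 0")
  case True
  then have "best (x # S) (regs s 5) 0"
    using s by (intro best_absent) (auto simp: found_def)
  then show ?thesis
    unfolding extend_def using True s by (simp add: runs_def wp_simps found_def matched_def)
next
  case False
  let ?q = "regs s 5" and ?j = "regs s 10"
  have j: "?j < r" "hd_run ?j \<le> ?q" "?q \<le> tl_run ?j" and q: "?q < n" "bwt ?q = x"
      "regs s 6 = sa ?q" "regs s 3 = n" "regs s 4 = r" "regs s 7 = lcp S (suf ?q)"
      "\<And>t. t < n \<Longrightarrow> bwt t = x \<Longrightarrow> lcp S (suf t) \<le> lcp S (suf ?q)"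
    using s False by (auto simp: found_def)
  have best: "best (x # S) (LF T ?q) (if sa ?q = 0 then 1 else Suc (lcp S (suf ?q)))"
    using best_extend[OF q(1,2)] q(7) by blast
  have LF: "LF T ?q = LF T (hd_run ?j) + (?q - hd_run ?j)" using LF_run j by blast
  have LF_n: "LF T ?q < n" "LF T (hd_run ?j) < n" "hd_run ?j \<le> n" "?j \<le> n"
    using LF_less q j hd_run_less r_le_n by (auto simp: less_imp_le)
  have minus: "apply_op w Minus ?q (hd_run ?j) = ?q - hd_run ?j"
    using j q le_n_word[of ?q] by (intro apply_Minus) auto
  have plus: "apply_op w Plus (LF T (hd_run ?j)) (?q - hd_run ?j) = LF T ?q"
    using LF LF_n le_n_word[of "LF T ?q"] by (subst apply_Plus) auto
  have sa_q: "sa ?q < n" using sa_less q by simp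
  have dec: "apply_op w Minus (sa ?q) 1 = sa ?q - 1" if "0 < sa ?q"
    using sa_q that le_n_word[of "sa ?q"] by (intro apply_Minus) auto
  have dec_n: "apply_op w Minus n 1 = n - 1"
    using n_pos le_n_word[of n] by (intro apply_Minus) linarith+
  have "lcp S (suf ?q) \<le> n"
    using lcp_le_length(2)[of S "suf ?q"] by (simp add: le_diff_conv)
  then have inc: "apply_op w Plus (lcp S (suf ?q)) 1 = Suc (lcp S (suf ?q))"
      "Suc (lcp S (suf ?q)) mod 2 ^ w = Suc (lcp S (suf ?q))"
    using word_bound by (simp_all add: apply_Plus)
  have sa_LF_q: "sa (LF T ?q) = (if sa ?q = 0 then n - 1 else sa ?q - 1)"
    using sa_LF[OF q(1)] sa_q by (simp add: prev_pos_eq)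
  show ?thesis
  proof (cases "sa ?q = 0")
    case True
    then show ?thesis
      unfolding extend_def
      using False j q best LF_n minus plus dec_n sa_LF_q
      by (simp add: runs_def wp_simps matched_def D_simps)
  next
    case pos: False
    then show ?thesis
      unfolding extend_def
      using False j q best LF_n minus plus dec inc sa_LF_q sa_q
      by (simp add: runs_def wp_simps matched_def D_simps)
  qed
qed

section \<open>The three phases and the total time\<close>

definition ready :: "nat \<Rightarrow> str \<Rightarrow> state \<Rightarrow> bool" where
  "ready k S s \<longleftrightarrow> matched S s \<and> regs s 0 = k \<and> regs s 8 = ms k S"

text \<open>A positive number of occurrences yields a row, whose suffix has length at most
  \<open>n\<close>. So the value fits into a word.\<close>

lemma ms_le_n: "0 < k \<Longrightarrow> ms k S \<le> n"
proof (cases "ms k S = 0")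
  case False
  assume k: "0 < k"
  have "k \<le> card {t. t < n \<and> ms k S \<le> lcp S (suf t)}"
    using le_ms_iff[of "ms k S" S k] occurrences_eq[of "ms k S" S] ms_le_length[of k S] False by simp
  then obtain t where "ms k S \<le> lcp S (suf t)" using k by fastforce
  then show ?thesis using lcp_le_length(2)[of S "suf t"] by simp
qed simp

lemma init_runs:
  assumes "regs s 0 = k" "regs s 2 = 0" "regs s 5 = 0" "regs s 7 = 0" "regs s 8 = 0"
  shows "runs' init_prog 20 (\<lambda>s'. ready k [] s' \<and> regs s' 2 = 0) s"
proof -
  \<comment> \<open>Every row is best for the empty pattern; row 0 is taken because its text
    position is \<open>n - 1\<close> by \<open>sa_0\<close>.\<close>
  have "best [] 0 0" using n_pos by (simp add: best_def)
  moreover have "apply_op w Minus n 1 = n - 1"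
    using n_pos le_n_word[of n] by (intro apply_Minus) linarith+
  ultimately show ?thesis
    unfolding init_prog_def
    using assms sa_0 r_le_n by (simp add: runs_def wp_simps ready_def matched_def D_simps)
qed

lemma step_runs:
  assumes s: "ready k S s" and k: "1 \<le> k" "k < 2 ^ w" and x: "x < 2 ^ w"
  shows "runs' step_prog ((30 + 7 * c) * lg n + 400 + k * (2 * look_bound + 60))
    (\<lambda>s'. ready k (x # S) s' \<and>
      regs s' 2 = (if ms k (x # S) \<le> ms k S then ms k S else 0)) (feed x s)"
  (is "runs' _ _ ?Q _")
  unfolding step_prog_def
proof (rule runs_Seq[OF find_row_runs[of S "feed x s" x]])
  show "matched S (feed x s)" using s by (auto simp: ready_def intro: matched_cong)
  fix s1 :: state
  assume s1: "found x S s1 \<and> frame (feed x s) s1"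
  have ms_n: "ms k S' \<le> n" for S' using ms_le_n k by simp
  show "runs' (extend ;; Assign 9 (Reg 8) ;; compute_ms ;;
     (Assign 8 (Reg 19) ;; Cond (Op Less (Reg 9) (Reg 8)) (Assign 2 (Const 0)) (Assign 2 (Reg 9))))
     (140 + k * (2 * look_bound + 60)) ?Q s1"
  proof (rule runs_Seq[OF extend_runs[of x S s1]])
    fix s2 :: state
    assume s2: "matched (x # S) s2 \<and> frame s1 s2"
    let ?s3 = "set_reg w 9 (ms k S) s2"
    have r8: "regs s2 8 = ms k S" "regs s2 0 = k" using s s1 s2 by (auto simp: ready_def)
    have 1: "runs' (Assign 9 (Reg 8)) 2 (\<lambda>s'. s' = ?s3) s2"
      using r8 by (simp add: runs_def wp_simps)
    show "runs' (Assign 9 (Reg 8) ;; compute_ms ;;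
       (Assign 8 (Reg 19) ;; Cond (Op Less (Reg 9) (Reg 8)) (Assign 2 (Const 0)) (Assign 2 (Reg 9))))
       (80 + k * (2 * look_bound + 60)) ?Q s2"
    proof (rule runs_Seq[OF 1, where ?B2.0 = "70 + k * (2 * look_bound + 60)"])
      fix s3 assume "s3 = ?s3"
      have m3: "matched (x # S) ?s3" using s2 by (auto intro: matched_cong)
      show "runs' (compute_ms ;;
         (Assign 8 (Reg 19) ;; Cond (Op Less (Reg 9) (Reg 8)) (Assign 2 (Const 0)) (Assign 2 (Reg 9))))
         (70 + k * (2 * look_bound + 60)) ?Q s3"
        unfolding \<open>s3 = ?s3\<close>
      proof (rule runs_Seq[OF compute_ms_runs[OF m3], where ?B2.0 = 20])
        fix s4 :: state
        assume s4: "regs s4 19 = ms (regs ?s3 0) (x # S) \<and> (\<forall>z<10. regs s4 z = regs ?s3 z)"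
        then have r4: "regs s4 19 = ms k (x # S)" "regs s4 9 = ms k S" "regs s4 0 = k"
          using r8 ms_n by simp_all
        have "matched (x # S) s4" using m3 s4 by (auto intro: matched_cong)
        then show "runs' (Assign 8 (Reg 19) ;;
           Cond (Op Less (Reg 9) (Reg 8)) (Assign 2 (Const 0)) (Assign 2 (Reg 9))) 20 ?Q s4"
          using r4 ms_n[of S] ms_n[of "x # S"]
          by (simp add: runs_def wp_simps ready_def matched_def)
      qed (use k r8 in auto)
    qed simp
  qed (use s1 in auto)
qed (use x in auto)

lemma fin_runs:
  assumes "ready k S s" "1 \<le> k"
  shows "runs' fin_prog 20 (\<lambda>s'. regs s' 2 = ms k S) s"
  using assms ms_le_n by (simp add: runs_def wp_simps fin_prog_def ready_def)

lemma runs_exec: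
  "runs' p B Q s \<Longrightarrow> \<exists>t s'. exec w M D p s t s' \<and> t \<le> B \<and> Q s'"
  by (auto simp: runs_def wp_def)

lemma finds_kmems:
  assumes k: "1 \<le> k" and P: "\<forall>x\<in>set P. x < 2 ^ w"
    and B: "k * (2100 + 27 * c) * lg n \<le> B"
  shows "finds_kmems_online w M D init_prog step_prog fin_prog T k P B"
proof -
  let ?m = "length P"
  define k' where "k' = min k (2 ^ w - 1)"
  have k': "1 \<le> k'" "k' < 2 ^ w" "k' \<le> k"
    using k word_bound by (auto simp: k'_def min_def)
  \<comment> \<open>If clamping changes \<open>k\<close>, both values exceed \<open>n\<close>, so
    both sides are 0.\<close>
  have ms: "ms k' S = ms k S" for S
  proof (cases "k < 2 ^ w")
    case True
    then show ?thesis by (simp add: k'_def)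
  next
    case False
    then have "n < k'" "n < k" using word_bound n_pos by (auto simp: k'_def)
    then show ?thesis by (simp add: ms_large)
  qed
  \<comment> \<open>A bound on a single step that also exceeds the time of \<open>init_prog\<close>
    and of \<open>fin_prog\<close>; thus \<open>3 * b\<close> per character pays for
    everything.\<close>
  define b where "b = k * (700 + 9 * c) * lg n"
  have kl: "1 \<le> k * lg n" using k lg_pos by (simp add: Suc_le_eq)
  have b: "20 \<le> b" "3 * b \<le> B"
  proof -
    have "20 * 1 \<le> (700 + 9 * c) * (k * lg n)" using kl by (intro mult_mono) auto
    then show "20 \<le> b" by (simp add: b_def algebra_simps)
    show "3 * b \<le> B" using B by (simp add: b_def algebra_simps)
  qed
  have step_b: "(30 + 7 * c) * lg n + 400 + k' * (2 * look_bound + 60) \<le> b"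
  proof -
    have "lg n \<le> k * lg n" "k \<le> k * lg n" using k lg_pos by auto
    moreover have "k' * (2 * look_bound + 60) \<le> k * (2 * look_bound + 60)"
      using k' by (intro mult_right_mono) auto
    moreover have "c * lg n \<le> c * (k * lg n)" using \<open>lg n \<le> k * lg n\<close> by (intro mult_left_mono) auto
    moreover have "b = 700 * (k * lg n) + 9 * (c * (k * lg n))"
      by (simp add: b_def algebra_simps)
    moreover have "k * (2 * look_bound + 60) = 60 * (k * lg n) + 2 * (c * (k * lg n)) + 200 * k"
      by (simp add: algebra_simps)
    moreover have "(30 + 7 * c) * lg n = 30 * lg n + 7 * (c * lg n)" by (simp add: algebra_simps)
    ultimately show ?thesis using kl by linarith
  qed
  obtain t0 s0 where s0: "exec w M D init_prog (start w k) t0 s0" "t0 \<le> 20" "ready k' [] s0"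
    using runs_exec[OF init_runs[of "start w k" k']] by (auto simp: start_def k'_def)
  define out where
    "out i = (if ms k (drop i P) \<le> ms k (drop (Suc i) P) then ms k (drop (Suc i) P) else 0)" for i
  \<comment> \<open>The states are constructed from right to left: \<open>j\<close> counts the
    characters processed. The guards \<open>j \<le> ?m\<close> and \<open>j < ?m\<close> allow an
    infinite sequence, as dependent choice demands.\<close>
  let ?R = "\<lambda>j s. (j \<le> ?m \<longrightarrow> ready k' (drop (?m - j) P) s) \<and> (j = 0 \<longrightarrow> s = s0)"
  let ?S = "\<lambda>j s s'. j < ?m \<longrightarrow> (\<exists>t. exec w M D step_prog (feed (P ! (?m - Suc j)) s) t s' \<and>
      t \<le> b \<and> regs s' 2 = out (?m - Suc j))"
  have "\<exists>f. \<forall>j. ?R j (f j) \<and> ?S j (f j) (f (Suc j))"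
  proof (rule dependent_nat_choice)
    show "\<exists>s. ?R 0 s" using s0(3) by auto
    fix s j
    assume R: "?R j s"
    show "\<exists>s'. ?R (Suc j) s' \<and> ?S j s s'"
    proof (cases "j < ?m")
      case True
      define i where "i = ?m - Suc j"
      have i: "Suc i = ?m - j" "i < ?m" using True by (auto simp: i_def)
      have ready: "ready k' (drop (Suc i) P) s" using R True i by simp
      have drop: "drop i P = P ! i # drop (Suc i) P"
        by (rule Cons_nth_drop_Suc[OF i(2), symmetric])
      have "P ! i < 2 ^ w" using P i by simp
      from runs_exec[OF step_runs[OF ready k'(1,2) this]] obtain t s' where
        s': "exec w M D step_prog (feed (P ! i) s) t s'"
          "t \<le> (30 + 7 * c) * lg n + 400 + k' * (2 * look_bound + 60)"
          "ready k' (drop i P) s'" "regs s' 2 = out i"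
        unfolding drop[symmetric] ms out_def by blast
      have "t \<le> b" using s'(2) step_b by (rule le_trans)
      then have "?R (Suc j) s' \<and> ?S j s s'" using s'(1,3,4) unfolding i_def by blast
      then show ?thesis by blast
    qed auto
  qed
  then obtain f where f: "\<And>j. ?R j (f j)" "\<And>j. ?S j (f j) (f (Suc j))" by blast
  define s where "s i = f (?m - i)" for i
  have s_m: "s ?m = s0" using f(1)[of 0] by (simp add: s_def)
  have s_ready: "ready k' (drop i P) (s i)" if "i \<le> ?m" for i
    using f(1)[of "?m - i"] that by (simp add: s_def)
  have "\<exists>t. exec w M D step_prog (feed (P ! i) (s (i + 1))) t (s i) \<and>
      t \<le> b \<and> regs (s i) 2 = out i" if "i < ?m" for i
    using f(2)[of "?m - Suc i"] that by (simp add: s_def Suc_diff_Suc)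
  then obtain t where t: "\<And>i. i < ?m \<Longrightarrow> exec w M D step_prog (feed (P ! i) (s (i + 1))) (t i) (s i) \<and>
      t i \<le> b \<and> regs (s i) 2 = out i"
    by metis
  obtain t1 s1 where s1: "exec w M D fin_prog (s 0) t1 s1" "t1 \<le> 20" "regs s1 2 = ms k P"
    using runs_exec[OF fin_runs[OF s_ready[of 0] k'(1)]] ms by auto
  \<comment> \<open>The output \<open>out i\<close> is the \<open>ms\<close> value at
    \<open>i + 1\<close>, or 0 if the value at \<open>i\<close> exceeds it, as in
    \<open>is_kmem_iff\<close>.\<close>
  have reports: "reports k P T (i + 1) (s i)" if "i + 1 < ?m" for i
    using t[of i] that by (auto simp: reports_def is_kmem_iff out_def)
  have fin: "reports k P T 0 s1"
    using s1(3) by (cases "P = []") (auto simp: reports_def is_kmem_iff)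
  have total: "t0 + (\<Sum>i<?m. t i) + t1 \<le> B * ?m" if "P \<noteq> []"
  proof -
    have "(\<Sum>i<?m. t i) \<le> ?m * b" using sum_bounded_above[of "{..<?m}" t b] t by simp
    moreover have "1 * b \<le> ?m * b" using that by (intro mult_right_mono) (auto simp: Suc_le_eq)
    moreover have "3 * b * ?m \<le> B * ?m" using b by (intro mult_right_mono) auto
    moreover have "3 * b * ?m = 3 * (?m * b)" by simp
    ultimately show ?thesis using s0(2) s1(2) b(1) by linarith
  qed
  have "t0 \<le> B" "t1 \<le> B" "\<And>i. i < ?m \<Longrightarrow> t i \<le> B"
    using s0(2) s1(2) b t by force+
  then show ?thesis
    unfolding finds_kmems_online_def
    using s0(1) s_m s1(1) t reports fin total
    by (intro exI[of _ s] exI[of _ t] exI[of _ t0] exI[of _ t1] exI[of _ s1]) auto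
qed

section \<open>Size of the stored arrays\<close>

lemma fits_words_D: "fits_words w D"
proof -
  have "\<forall>v\<in>set A. v \<le> n" if "A \<in> set D" for A
  proof -
    have "sa (row p - 1) \<le> n" if "p \<in> sa ` heads" for p
    proof -
      have "row p < n" using that heads_less by auto
      then have "row p - 1 < n" by linarith
      then show ?thesis by (rule less_imp_le[OF sa_less])
    qed
    moreover have "LF T (hd_run j) \<le> n" "hd_run j \<le> n" if "j < r" for j
      using hd_run_less[OF that] LF_less[of "hd_run j"] by (simp_all add: less_imp_le)
    moreover have "sa q \<le> n" if "q \<in> heads \<union> tails" for q
      using that heads_less tails_less sa_less[of q] by (auto simp: less_imp_le)
    ultimately show ?thesis
      using \<open>A \<in> set D\<close> r_le_n by (auto simp: D_def sa_less less_imp_le)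
  qed
  then show ?thesis by (auto simp: fits_words_def le_n_word)
qed

text \<open>There are two single numbers and six arrays of length \<open>r\<close>; since
  \<open>r\<close> is positive, the two words are absorbed into \<open>2 * r\<close>.\<close>

lemma size_D: "size_in_bits w D \<le> 8 * w * r"
proof -
  have "card (sa ` heads) = r" "card (sa ` tails) = r"
    using sample_list(1)[OF head_samples] sample_list(1)[OF tail_samples] by simp_all
  then have "size_in_bits w D = w * (2 + 6 * r)" by (simp add: size_in_bits_def D_def)
  also have "\<dots> \<le> w * (8 * r)" using r_pos by (intro mult_left_mono) auto
  finally show ?thesis by simp
qed

end

theorem theorem2:
  shows "\<exists>init step fin :: com. \<forall>c cw :: nat. \<exists>C :: nat. \<forall>(T :: str) (w :: nat) (M :: moni).
    is_text T \<longrightarrow>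
    lg (length T) < w \<longrightarrow> w \<le> cw * lg (length T) \<longrightarrow>
    (\<forall>x \<in> set T. x < 2 ^ w) \<longrightarrow>
    is_moni c T M \<longrightarrow>
    (\<exists>D :: nat list list.
       fits_words w D \<and>
       size_in_bits w D \<le> C * num_runs T * lg (length T) \<and>
       (\<forall>(k :: nat) (P :: str). k \<ge> 1 \<longrightarrow> (\<forall>x \<in> set P. x < 2 ^ w) \<longrightarrow>
          finds_kmems_online w M D init step fin T k P (C * k * lg (length T))))"
proof (rule exI[of _ init_prog], rule exI[of _ step_prog], rule exI[of _ fin_prog], intro allI)
  fix c cw :: nat
  \<comment> \<open>The first two summands are the time constant of \<open>finds_kmems\<close>. The
    last one comes from \<open>size_D\<close>, where \<open>w \<le> cw * lg (length T)\<close> turns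
    words into multiples of \<open>lg (length T)\<close> bits.\<close>
  let ?C = "2100 + 27 * c + 8 * cw"
  have "\<exists>D. fits_words w D \<and> size_in_bits w D \<le> ?C * num_runs T * lg (length T) \<and>
       (\<forall>k P. k \<ge> 1 \<longrightarrow> (\<forall>x \<in> set P. x < 2 ^ w) \<longrightarrow>
          finds_kmems_online w M D init_prog step_prog fin_prog T k P (?C * k * lg (length T)))"
    if "is_text T" "lg (length T) < w" and w: "w \<le> cw * lg (length T)"
      and "\<forall>x \<in> set T. x < 2 ^ w" "is_moni c T M" for T w M
  proof -
    interpret moni_text T c w M using that by unfold_locales
    have "size_in_bits w D \<le> 8 * w * num_runs T" by (rule size_D)
    also have "\<dots> \<le> 8 * (cw * lg (length T)) * num_runs T"
      using w by (intro mult_right_mono mult_left_mono) auto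
    also have "\<dots> \<le> ?C * num_runs T * lg (length T)" by (simp add: algebra_simps)
    finally have "size_in_bits w D \<le> ?C * num_runs T * lg (length T)" .
    moreover have "finds_kmems_online w M D init_prog step_prog fin_prog T k P (?C * k * lg (length T))"
      if "k \<ge> 1" "\<forall>x \<in> set P. x < 2 ^ w" for k P
      by (rule finds_kmems[OF that]) (simp add: algebra_simps)
    ultimately show ?thesis using fits_words_D by blast
  qed
  then show "\<exists>C. \<forall>T w M. is_text T \<longrightarrow> lg (length T) < w \<longrightarrow> w \<le> cw * lg (length T) \<longrightarrow>
    (\<forall>x \<in> set T. x < 2 ^ w) \<longrightarrow> is_moni c T M \<longrightarrow>
    (\<exists>D. fits_words w D \<and> size_in_bits w D \<le> C * num_runs T * lg (length T) \<and>
       (\<forall>k P. k \<ge> 1 \<longrightarrow> (\<forall>x \<in> set P. x < 2 ^ w) \<longrightarrow>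
          finds_kmems_online w M D init_prog step_prog fin_prog T k P (C * k * lg (length T))))"
    by blast
qed

end
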